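(* Let $\mathbf{s}$ be a tetrahedron (considered as an abstract simplicial complex). Let $\mathcal{S}$ be an induced triangulation of $\mathbf{s}$ which uses, besides the four vertices of $\mathbf{s}$, exactly $b_2$ additional vertices in the relative interiors of the edges of $\mathbf{s}$, $b_3$ additional vertices in the relative interiors of the $2$-faces of $\mathbf{s}$, and $b_4$ additional vertices in the interior of $\mathbf{s}$, and put $\mathfrak{b}:=4+b_2+b_3+b_4>4$. Then $\mathcal{S}$ has at most $$\mathfrak{f}_3(\mathrm{CycP}_4(\mathfrak{b}))-2b_2-b_3-1$$ facets (i.e. $3$-dimensional faces). In particular, the same bound holds for every geometric triangulation $\mathcal{S}$ of a $3$-dimensional simplex $\mathbf{s}$ whose vertex set $\mathcal{V}\subset\mathbf{s}$ consists of the four vertices of $\mathbf{s}$ and of $b_2$, $b_3$, $b_4$ points in the relative interiors of its edges, its $2$-faces and of $\mathbf{s}$ itself, respectively.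
   Context: $\mathfrak{f}_3(\mathrm{CycP}_4(\mathfrak{b}))=\frac12\mathfrak{b}(\mathfrak{b}-3)$ is the number of facets of the cyclic $4$-polytope with $\mathfrak{b}$ vertices. A subcomplex $\mathcal{S}'$ of an abstract simplicial complex $\mathcal{S}$ is called induced if every face $F\in\mathcal{S}$ with $\mathrm{vert}(F)\subset\mathrm{vert}(\mathcal{S}')$ belongs to $\mathcal{S}'$. Let $\mathbf{s}$ be an abstract $d$-simplex, considered as the simplicial complex consisting of itself together with all of its faces. An abstract simplicial complex $\mathcal{S}$ is an induced triangulation of $\mathbf{s}$ if there is a piecewise linear homeomorphism $\varphi:\mathbf{s}\to\mathcal{S}$ (of geometric realizations) such that for every face $F$ of $\mathbf{s}$ the image $\varphi(F)$ is (the support of) an induced subcomplex of $\mathcal{S}$. A vertex of $\mathcal{S}$ is said to lie in the relative interior of a face $F$ of $\mathbf{s}$ if it lies in the image under $\varphi$ of the relative interior of $F$. A geometric triangulation of a geometric simplex $\mathbf{s}$ is a geometric simplicial complex $\mathcal{S}$ with $|\mathcal{S}|=\mathbf{s}$. *)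

theory Defs
  imports "HOL-Analysis.Analysis"
begin

definition num_faces :: "int \<Rightarrow> 'a::euclidean_space set \<Rightarrow> nat" where
  "num_faces k P = card {F. F face_of P \<and> aff_dim F = k}"

definition moment_curve4 :: "real \<Rightarrow> real ^ 4" where
  "moment_curve4 t = vector [t, t ^ 2, t ^ 3, t ^ 4]"

text \<open>
  The combinatorial type of a cyclic polytope does not depend on the choice of the parameters
  of its vertices on the moment curve; the parameters used here are \<open>1, \<dots>, n\<close>.
\<close>

definition cyclic_polytope4 :: "nat \<Rightarrow> (real ^ 4) set" where
  "cyclic_polytope4 n = convex hull ((\<lambda>i. moment_curve4 (real i)) ` {1..n})"

text \<open>Complexes are finite, and the empty set counts as a face (of dimension \<open>-1\<close>).\<close>

definition abstract_complex :: "'v set set \<Rightarrow> bool" where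
  "abstract_complex S \<longleftrightarrow>
     finite S \<and> S \<noteq> {} \<and> (\<forall>F\<in>S. finite F) \<and> (\<forall>F\<in>S. \<forall>G. G \<subseteq> F \<longrightarrow> G \<in> S)"

abbreviation vert :: "'v set set \<Rightarrow> 'v set" where
  "vert S \<equiv> \<Union>S"

definition induced_subcomplex :: "'v set set \<Rightarrow> 'v set set \<Rightarrow> bool" where
  "induced_subcomplex S' S \<longleftrightarrow>
     abstract_complex S' \<and> S' \<subseteq> S \<and> (\<forall>F\<in>S. F \<subseteq> vert S' \<longrightarrow> F \<in> S')"

text \<open>
  A geometric realization of \<open>S\<close> places the vertices in a Euclidean space so that the convex
  hulls of the faces are simplices forming a geometric simplicial complex. Any two
  realizations are identified by a piecewise linear homeomorphism that is affine on each simplex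
  and matches the vertices.
\<close>

definition geometric_realization :: "('v \<Rightarrow> 'a::euclidean_space) \<Rightarrow> 'v set set \<Rightarrow> bool" where
  "geometric_realization \<rho> S \<longleftrightarrow>
     inj_on \<rho> (vert S) \<and>
     (\<forall>F\<in>S. \<not> affine_dependent (\<rho> ` F)) \<and>
     simplicial_complex ((\<lambda>F. convex hull (\<rho> ` F)) ` S)"

definition support :: "('v \<Rightarrow> 'a::euclidean_space) \<Rightarrow> 'v set set \<Rightarrow> 'a set" where
  "support \<rho> S = (\<Union>F\<in>S. convex hull (\<rho> ` F))"

definition piecewise_linear_on ::
  "'a::euclidean_space set \<Rightarrow> ('a \<Rightarrow> 'b::euclidean_space) \<Rightarrow> bool" where
  "piecewise_linear_on X f \<longleftrightarrow>
     (\<exists>\<K>. simplicial_complex \<K> \<and> \<Union>\<K> = X \<and>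
        (\<forall>K\<in>\<K>. \<exists>h c. linear h \<and> (\<forall>x\<in>K. f x = h x + c)))"

text \<open>The inverse of a piecewise linear homeomorphism is automatically piecewise linear.\<close>

definition pl_homeomorphism ::
  "'a::euclidean_space set \<Rightarrow> 'b::euclidean_space set \<Rightarrow> ('a \<Rightarrow> 'b) \<Rightarrow> bool" where
  "pl_homeomorphism X Y f \<longleftrightarrow> piecewise_linear_on X f \<and> (\<exists>g. homeomorphism X Y f g)"

text \<open>
  The abstract simplex with vertex set \<open>T\<close>, together with all its faces, is the complex
  \<open>Pow T\<close>. The realizations \<open>r\<close>, \<open>\<rho>\<close> and the homeomorphism \<open>\<phi>\<close> are explicit
  parameters, because the position of a vertex of \<open>S\<close> relative to the faces of the simplex
  is defined in terms of them.
\<close>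

definition induced_triangulation ::
  "'t set \<Rightarrow> ('t \<Rightarrow> 'a::euclidean_space) \<Rightarrow> 'v set set \<Rightarrow> ('v \<Rightarrow> 'b::euclidean_space)
     \<Rightarrow> ('a \<Rightarrow> 'b) \<Rightarrow> bool" where
  "induced_triangulation T r S \<rho> \<phi> \<longleftrightarrow>
     abstract_complex (Pow T) \<and> geometric_realization r (Pow T) \<and>
     abstract_complex S \<and> geometric_realization \<rho> S \<and>
     pl_homeomorphism (support r (Pow T)) (support \<rho> S) \<phi> \<and>
     (\<forall>F\<in>Pow T. \<exists>S'. induced_subcomplex S' S \<and>
        \<phi> ` (convex hull (r ` F)) = support \<rho> S')"

definition verts_in_rel_interiors ::
  "nat \<Rightarrow> 't set \<Rightarrow> ('t \<Rightarrow> 'a::euclidean_space) \<Rightarrow> 'v set set \<Rightarrow> ('v \<Rightarrow> 'b::euclidean_space)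
     \<Rightarrow> ('a \<Rightarrow> 'b) \<Rightarrow> 'v set" where
  "verts_in_rel_interiors k T r S \<rho> \<phi> =
     {v \<in> vert S. \<exists>F\<in>Pow T. card F = k + 1 \<and> \<rho> v \<in> \<phi> ` rel_interior (convex hull (r ` F))}"

definition abstract_faces :: "nat \<Rightarrow> 'v set set \<Rightarrow> 'v set set" where
  "abstract_faces k S = {F \<in> S. card F = k + 1}"

definition geometric_triangulation :: "'a::euclidean_space set \<Rightarrow> 'a set set \<Rightarrow> bool" where
  "geometric_triangulation s \<S> \<longleftrightarrow> simplicial_complex \<S> \<and> \<Union>\<S> = s"

definition geom_vert :: "'a::euclidean_space set set \<Rightarrow> 'a set" where
  "geom_vert \<S> = {v. {v} \<in> \<S>}"

definition geom_verts_in_rel_interiors ::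
  "int \<Rightarrow> 'a::euclidean_space set \<Rightarrow> 'a set set \<Rightarrow> 'a set" where
  "geom_verts_in_rel_interiors k s \<S> =
     {v \<in> geom_vert \<S>. \<exists>F. F face_of s \<and> aff_dim F = k \<and> v \<in> rel_interior F}"

end

theory Submission
  imports Defs
begin

text \<open>
  A finite disjoint union of relatively open bounded convex sets has a well-defined Euler
  characteristic \<open>\<Sum>(-1)\<^sup>d\<^sup>i\<^sup>m\<close>, also when only the cells near a given point are counted. These numbers
  can be computed in \<open>S\<close> or, through the piecewise linear homeomorphism, in the face complex of the
  tetrahedron. Hence \<open>f\<^sub>0 - f\<^sub>1 + f\<^sub>2 - f\<^sub>3 = 1\<close>, and the alternating sum over the faces containing a vertex
  is -1 for interior and 0 for boundary vertices, so that \<open>f\<^sub>0 - 2f\<^sub>1 + 3f\<^sub>2 - 4f\<^sub>3 = -b\<^sub>4\<close>. Eliminating \<open>f\<^sub>2\<close>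
  gives \<open>f\<^sub>3 = f\<^sub>1 - 2f\<^sub>0 + 3 + b\<^sub>4\<close>. Finally at least \<open>b\<^sub>2\<close> pairs of vertices are not edges: a corner of a
  subdivided edge has only one neighbour on that edge. The right-hand side is compared with
  \<open>b(b - 3)/2\<close>, a lower bound for the number of facets of the cyclic polytope by Gale's evenness condition.
\<close>

section \<open>The Euler relation for relatively open convex sets\<close>

text \<open>The obstacle is that \<open>\<phi>\<close> is affine only on the simplices of some
  subdivision of the tetrahedron unrelated to \<open>S\<close>: their images need neither refine
  \<open>S\<close> nor be refined by it, so faces cannot be matched. Both families still cut the
  same set into convex pieces, and additivity of the Euler characteristic compares them without a
  common refinement. The pieces are taken relatively open so that they are disjoint and no
  inclusion-exclusion terms arise. Counting the pieces near one point stands in for the usual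
  statement that vertex links are spheres or disks. The coefficients 1, -2, 3, -4 appear because a
  sum over all vertex stars meets each face once per vertex. In the final bound one
  \<open>b\<^sub>2\<close> comes from the missing edges; the other \<open>b\<^sub>2\<close> and the
  \<open>b\<^sub>3\<close> come from substituting
  \<open>b\<^sub>4 = b - 4 - b\<^sub>2 - b\<^sub>3\<close>.\<close>

lemma bounded_convex_rel_open_real_cases:
  fixes J :: "real set"
  assumes "convex J" "bounded J" "rel_open J" "J \<noteq> {}"
  obtains t where "J = {t}" | lo hi where "lo < hi" "J = {lo<..<hi}"
proof -
  have iv: "\<And>a b x. \<lbrakk>a \<in> J; b \<in> J; a \<le> x; x \<le> b\<rbrakk> \<Longrightarrow> x \<in> J"
    using assms(1) by (meson is_interval_1 is_interval_convex_1)
  show thesis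
  proof (cases "\<exists>t. J = {t}")
    case False
    then obtain u v where uv: "u \<in> J" "v \<in> J" "u < v"
    proof -
      obtain x where x: "x \<in> J" using assms(4) by blast
      then obtain y where "y \<in> J" "y \<noteq> x" using False by blast
      then show ?thesis using x that by (cases "x < y") auto
    qed
    have "interior J \<noteq> {}"
    proof -
      have "{u<..<v} \<subseteq> interior J"
        using iv[OF uv(1,2)] by (intro interior_maximal subsetI) simp_all
      then show ?thesis using uv(3) by (metis greaterThanLessThan_empty_iff not_less subset_empty)
    qed
    then have "open J"
      using assms(3) by (metis rel_open_def interior_eq rel_interior_nonempty_interior)
    have bdd: "bdd_below J" "bdd_above J"
      using assms(2) bounded_imp_bdd_below bounded_imp_bdd_above by auto
    have "\<exists>y\<in>J. y < x" "\<exists>y\<in>J. x < y" if "x \<in> J" for x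
    proof -
      obtain e where "e > 0" "ball x e \<subseteq> J"
        using \<open>open J\<close> \<open>x \<in> J\<close> open_contains_ball by blast
      then have "x - e / 2 \<in> J" "x + e / 2 \<in> J"
        by (auto simp: subset_iff dist_real_def)
      then show "\<exists>y\<in>J. y < x" "\<exists>y\<in>J. x < y"
        using \<open>e > 0\<close> by (auto intro: bexI[of _ "x - e / 2"] bexI[of _ "x + e / 2"])
    qed
    then have "J \<subseteq> {Inf J<..<Sup J}"
      using cInf_less_iff[OF assms(4) bdd(1)] less_cSup_iff[OF assms(4) bdd(2)] by auto
    moreover have "{Inf J<..<Sup J} \<subseteq> J"
      using iv cInf_less_iff[OF assms(4) bdd(1)] less_cSup_iff[OF assms(4) bdd(2)]
      by (meson greaterThanLessThan_iff less_imp_le subsetI)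
    ultimately have "J = {Inf J<..<Sup J}" by blast
    moreover from this have "Inf J < Sup J"
      using uv(1) by (metis empty_iff greaterThanLessThan_empty not_less)
    ultimately show thesis using that(2) by blast
  qed (use that in auto)
qed

text \<open>The Euler characteristic is read off the indicator sum by adding up its jumps to the right,
  which vanish away from the endpoints: a point jumps by 1 and an open interval by -1.\<close>

lemma euler_relation_real:
  fixes J :: "'i \<Rightarrow> real set" and c :: "'i \<Rightarrow> int"
  assumes fin: "finite I"
    and J: "\<And>i. i \<in> I \<Longrightarrow> (\<exists>t. J i = {t}) \<or> (\<exists>lo hi. lo < hi \<and> J i = {lo<..<hi})"
    and zero: "\<And>t. (\<Sum>i\<in>{i\<in>I. t \<in> J i}. c i) = 0"
  shows "(\<Sum>i\<in>I. if is_singleton (J i) then c i else - c i) = 0"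
proof -
  define Q where "Q = (\<Union>i\<in>I. {Inf (J i), Sup (J i)})"
  have "finite Q" using fin by (simp add: Q_def)
  define D where "D = (\<lambda>(x,y). y - x) ` {(x,y). x \<in> Q \<and> y \<in> Q \<and> x < y}"
  have "finite D"
    unfolding D_def using \<open>finite Q\<close> by (intro finite_imageI finite_subset[OF _ finite_cartesian_product[OF \<open>finite Q\<close> \<open>finite Q\<close>]]) auto
  \<comment> \<open>Half the smallest gap of \<open>Q\<close>, so that \<open>q + e\<close> stays
    strictly before the next endpoint; the inserted 1 keeps \<open>Min\<close> meaningful when
    \<open>D\<close> is empty.\<close>
  define e where "e = Min (insert 1 D) / 2"
  have "e > 0"
    unfolding e_def using \<open>finite D\<close> by (auto simp: D_def)
  have gap: "x + e < y" if "x \<in> Q" "y \<in> Q" "x < y" for x y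
  proof -
    have "y - x \<in> D" using that by (force simp: D_def)
    then have "Min (insert 1 D) \<le> y - x" using \<open>finite D\<close> by auto
    then show ?thesis using \<open>e > 0\<close> unfolding e_def by linarith
  qed
  \<comment> \<open>The value at \<open>q + e\<close> plays the role of the right-hand limit at
    \<open>q\<close>.\<close>
  define jump where "jump i q = of_bool (q \<in> J i) - (of_bool (q + e \<in> J i) :: int)" for i q
  have jump_sum: "(\<Sum>q\<in>Q. jump i q) = (if is_singleton (J i) then 1 else - 1)" if i: "i \<in> I" for i
    using J[OF i]
  proof
    assume "\<exists>t. J i = {t}"
    then obtain t where t: "J i = {t}" by blast
    have "Inf (J i) \<in> Q" using i by (auto simp: Q_def)
    then have "t \<in> Q" using t by simp
    have "jump i q = (if q = t then 1 else 0)" if "q \<in> Q" for q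
      using gap[OF that \<open>t \<in> Q\<close>] \<open>e > 0\<close> unfolding jump_def t by auto
    then have "(\<Sum>q\<in>Q. jump i q) = (\<Sum>q\<in>Q. if q = t then 1 else 0)" by simp
    then show ?thesis using t \<open>finite Q\<close> \<open>t \<in> Q\<close> by (simp add: is_singleton_def)
  next
    assume "\<exists>lo hi. lo < hi \<and> J i = {lo<..<hi}"
    then obtain lo hi where lh: "lo < hi" "J i = {lo<..<hi}" by blast
    have "Inf (J i) \<in> Q" "Sup (J i) \<in> Q" using i by (auto simp: Q_def)
    then have Q: "lo \<in> Q" "hi \<in> Q" using lh by simp_all
    have ns: "\<not> is_singleton (J i)"
      using lh by (metis is_singleton_def infinite_Ioo finite.emptyI finite_insert)
    \<comment> \<open>At \<open>lo\<close> the point is outside but its right-hand limit inside,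
      which gives -1; at \<open>hi\<close> both terms vanish.\<close>
    have "jump i q = (if q = lo then - 1 else 0)" if "q \<in> Q" for q
    proof -
      consider "q < lo" | "q = lo" | "lo < q" "q < hi" | "hi \<le> q" by linarith
      then show ?thesis
        using gap[OF that Q(1)] gap[OF that Q(2)] gap[OF Q lh(1)] \<open>e > 0\<close> lh(1)
        by cases (simp_all add: jump_def lh(2))
    qed
    then have "(\<Sum>q\<in>Q. jump i q) = (\<Sum>q\<in>Q. if q = lo then - 1 else 0)" by simp
    then show ?thesis using ns \<open>finite Q\<close> Q by simp
  qed
  have z: "(\<Sum>i\<in>I. c i * of_bool (t \<in> J i)) = 0" for t
    using zero[of t] fin by (simp add: sum.inter_filter of_bool_def if_distrib cong: if_cong)
  have "(\<Sum>i\<in>I. if is_singleton (J i) then c i else - c i) = (\<Sum>i\<in>I. c i * (\<Sum>q\<in>Q. jump i q))"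
    by (intro sum.cong) (auto simp: jump_sum)
  also have "\<dots> = (\<Sum>q\<in>Q. \<Sum>i\<in>I. c i * jump i q)"
    by (simp add: sum_distrib_left sum.swap[of _ Q I])
  also have "\<dots> = 0"
    using z by (simp add: jump_def right_diff_distrib sum_subtractf)
  finally show ?thesis .
qed

text \<open>The slice is open in the intersection of the affine hull with the hyperplane, so it has
  the dimension of that affine set. For a closed set merely touching the hyperplane the dimension
  could drop by more than one.\<close>

lemma aff_dim_slice:
  fixes C :: "'a::euclidean_space set"
  assumes "convex C" "rel_open C" "C \<inter> {x. b \<bullet> x = t} \<noteq> {}"
  shows "aff_dim (C \<inter> {x. b \<bullet> x = t}) = (if C \<subseteq> {x. b \<bullet> x = t} then aff_dim C else aff_dim C - 1)"
proof -
  let ?H = "{x. b \<bullet> x = t}"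
  have "openin (top_of_set (affine hull C)) C"
    using assms(2) by (simp add: rel_open)
  then have op: "openin (top_of_set (affine hull C \<inter> ?H)) (C \<inter> ?H)"
    by (auto simp: openin_open)
  have "aff_dim (C \<inter> ?H) = aff_dim (affine hull C \<inter> ?H)"
    using aff_dim_openin[OF op] assms(3) by (simp add: affine_Int affine_hyperplane)
  moreover have "affine hull C \<subseteq> ?H \<longleftrightarrow> C \<subseteq> ?H"
    by (metis affine_hyperplane hull_minimal hull_subset order_trans)
  moreover have "affine hull C \<inter> ?H \<noteq> {}"
    using assms(3) hull_subset by fastforce
  ultimately show ?thesis
    using aff_dim_affine_Int_hyperplane[of "affine hull C" b t] by (simp add: aff_dim_affine_hull)
qed

lemma rel_open_slice:
  fixes C :: "'a::euclidean_space set"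
  assumes "convex C" "rel_open C" "C \<inter> {x. b \<bullet> x = t} \<noteq> {}"
  shows "rel_open (C \<inter> {x. b \<bullet> x = t})"
  using assms convex_affine_rel_interior_Int[of C "{x. b \<bullet> x = t}"]
  by (simp add: rel_open_def affine_hyperplane)

text \<open>Slicing by the hyperplanes orthogonal to one basis vector after the other reduces the claim to
  the real line: the sign of a slice of \<open>C\<close> times the sign of the projection of \<open>C\<close> is the sign of \<open>C\<close>.\<close>

lemma euler_relation:
  fixes C :: "'i \<Rightarrow> 'a::euclidean_space set" and c :: "'i \<Rightarrow> int"
  assumes "finite I"
    and "\<And>i. i \<in> I \<Longrightarrow> convex (C i) \<and> bounded (C i) \<and> rel_open (C i) \<and> C i \<noteq> {}"
    and "\<And>x. (\<Sum>i\<in>{i\<in>I. x \<in> C i}. c i) = 0"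
  shows "(\<Sum>i\<in>I. c i * (-1) ^ nat (aff_dim (C i))) = 0"
proof -
  \<comment> \<open>Generalised for induction: coordinates outside \<open>B\<close> agree on all
    points of all cells. For empty \<open>B\<close> every cell is the same single point and the
    pointwise hypothesis is the claim; for \<open>Basis\<close> the condition is vacuous.\<close>
  have "(\<Sum>i\<in>I. c i * (-1) ^ nat (aff_dim (C i))) = 0"
    if "finite B" "B \<subseteq> Basis" "finite I"
    and "\<And>i. i \<in> I \<Longrightarrow> convex (C i) \<and> bounded (C i) \<and> rel_open (C i) \<and> C i \<noteq> {}"
    and "\<And>x. (\<Sum>i\<in>{i\<in>I. x \<in> C i}. c i) = 0"
    and "\<And>i j x y b. \<lbrakk>i \<in> I; j \<in> I; x \<in> C i; y \<in> C j; b \<in> Basis - B\<rbrakk> \<Longrightarrow> b \<bullet> x = b \<bullet> y"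
    for B and I :: "'i set" and C :: "'i \<Rightarrow> 'a set"
    using that
  proof (induction B arbitrary: I C rule: finite_induct)
    case (empty I C)
    have eq: "x = y" if "i \<in> I" "j \<in> I" "x \<in> C i" "y \<in> C j" for i j x y
    proof (rule euclidean_eqI)
      show "x \<bullet> b = y \<bullet> b" if "b \<in> Basis" for b
        using empty.prems(5)[OF \<open>i \<in> I\<close> \<open>j \<in> I\<close> \<open>x \<in> C i\<close> \<open>y \<in> C j\<close>, of b] that by (simp add: inner_commute)
    qed
    show ?case
    proof (cases "I = {}")
      case False
      then obtain k z where k: "k \<in> I" "z \<in> C k" using empty.prems(3) by blast
      have "C i = {z}" if "i \<in> I" for i
        using eq[OF that k(1) _ k(2)] empty.prems(3)[OF that] by blast
      then show ?thesis using empty.prems(4)[of z] by (simp cong: conj_cong)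
    qed simp
  next
    case (insert b B I C)
    let ?H = "\<lambda>t. {x. b \<bullet> x = t}"
    define J where "J i = (\<lambda>x. b \<bullet> x) ` C i" for i
    \<comment> \<open>This is \<open>c i\<close> times the sign of any nonempty slice of
      \<open>C i\<close>: a cell inside one hyperplane is its own slice, any other cell loses one
      dimension. The value does not depend on \<open>t\<close>, so the slices yield a relation on
      the line with coefficients \<open>d\<close>.\<close>
    define d where "d i = c i * (if is_singleton (J i) then 1 else - 1) * (-1) ^ nat (aff_dim (C i))" for i
    have mem: "t \<in> J i \<longleftrightarrow> C i \<inter> ?H t \<noteq> {}" for t i
      by (auto simp: J_def)
    have J: "(\<exists>t. J i = {t}) \<or> (\<exists>lo hi. lo < hi \<and> J i = {lo<..<hi})" if "i \<in> I" for i
    proof -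
      note C = insert.prems(3)[OF that]
      have lin: "linear (\<lambda>x. b \<bullet> x)" by (simp add: bounded_linear_inner_right bounded_linear.linear)
      have "convex (J i)" "bounded (J i)" "rel_open (J i)" "J i \<noteq> {}"
        using C lin rel_interior_convex_linear_image[OF lin, of "C i"]
        by (auto simp: J_def rel_open_def convex_linear_image bounded_linear_image bounded_linear_inner_right)
      then show ?thesis using bounded_convex_rel_open_real_cases by metis
    qed
    have slice: "(\<Sum>i\<in>{i\<in>I. t \<in> J i}. d i) = 0" for t
    proof -
      let ?I = "{i\<in>I. t \<in> J i}"
      have "(\<Sum>i\<in>?I. c i * (-1) ^ nat (aff_dim (C i \<inter> ?H t))) = 0"
      proof (rule insert.IH)
        show "B \<subseteq> Basis" "finite ?I" using insert.prems by auto
        show "convex (C i \<inter> ?H t) \<and> bounded (C i \<inter> ?H t) \<and> rel_open (C i \<inter> ?H t) \<and> C i \<inter> ?H t \<noteq> {}" if "i \<in> ?I" for i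
          using that insert.prems(3)[of i] rel_open_slice[of "C i" b t] 
          by (auto simp: mem bounded_Int convex_Int convex_hyperplane)
        show "(\<Sum>i\<in>{i\<in>?I. x \<in> C i \<inter> ?H t}. c i) = 0" for x
        proof (cases "b \<bullet> x = t")
          case True
          then have "{i\<in>?I. x \<in> C i \<inter> ?H t} = {i\<in>I. x \<in> C i}" by (auto simp: mem)
          then show ?thesis using insert.prems(4)[of x] by simp
        next
          case False
          then have "{i\<in>?I. x \<in> C i \<inter> ?H t} = {}" by auto
          then show ?thesis by (simp only: sum.empty)
        qed
        show "b' \<bullet> x = b' \<bullet> y" if "i \<in> ?I" "j \<in> ?I" "x \<in> C i \<inter> ?H t" "y \<in> C j \<inter> ?H t" "b' \<in> Basis - B" for i j x y b'
          using that insert.prems(5)[of i j x y b'] by (cases "b' = b") auto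
      qed
      moreover have "(\<Sum>i\<in>?I. c i * (-1) ^ nat (aff_dim (C i \<inter> ?H t))) = (\<Sum>i\<in>?I. d i)"
      proof (rule sum.cong[OF refl])
        fix i assume i: "i \<in> ?I"
        show "c i * (-1) ^ nat (aff_dim (C i \<inter> ?H t)) = d i"
        proof (cases "C i \<subseteq> ?H t")
          case True
          then have "J i = {t}" using i by (auto simp: J_def)
          moreover have "C i \<inter> ?H t = C i" using True by blast
          ultimately show ?thesis by (simp add: d_def)
        next
          case False
          have ne: "C i \<inter> ?H t \<noteq> {}" using i mem by auto
          obtain x y where "x \<in> C i" "y \<in> C i" "b \<bullet> x \<noteq> t" "b \<bullet> y = t"
            using False ne by blast
          then have "\<not> is_singleton (J i)"
            unfolding J_def is_singleton_def by (metis image_eqI singletonD)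
          moreover have a: "aff_dim (C i \<inter> ?H t) = aff_dim (C i) - 1"
            using aff_dim_slice[of "C i" b t] i insert.prems(3)[of i] ne False by auto
          \<comment> \<open>Needed because \<open>nat\<close> truncates: below dimension 0 the
            change of parity would be lost.\<close>
          moreover have "aff_dim (C i \<inter> ?H t) \<ge> 0" using aff_dim_geq[of "C i \<inter> ?H t"] aff_dim_empty[of "C i \<inter> ?H t"] ne by linarith
          then have "nat (aff_dim (C i)) = Suc (nat (aff_dim (C i \<inter> ?H t)))"
            using a by linarith
          ultimately show ?thesis by (simp add: d_def)
        qed
      qed
      ultimately show ?thesis by simp
    qed
    have "(\<Sum>i\<in>I. if is_singleton (J i) then d i else - d i) = 0"
      by (rule euler_relation_real[OF insert.prems(2) J slice])
    moreover have "(if is_singleton (J i) then d i else - d i) = c i * (-1) ^ nat (aff_dim (C i))" for i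
      by (simp add: d_def)
    ultimately show ?case by simp
  qed
  from this[of Basis I C] show ?thesis using assms by simp
qed

section \<open>Piecewise linear invariance\<close>

text \<open>Give the cells of one family weight 1 and those of the other -1, on the disjoint sum of
  the index sets. Each point of the common union lies in exactly one cell of each family, so the
  weights cancel pointwise.\<close>

lemma euler_partition:
  fixes A :: "'i \<Rightarrow> 'a::euclidean_space set" and B :: "'j \<Rightarrow> 'a set"
  assumes fin: "finite I" "finite J"
    and A: "\<And>i. i \<in> I \<Longrightarrow> convex (A i) \<and> bounded (A i) \<and> rel_open (A i) \<and> A i \<noteq> {}"
    and B: "\<And>j. j \<in> J \<Longrightarrow> convex (B j) \<and> bounded (B j) \<and> rel_open (B j) \<and> B j \<noteq> {}"
    and disj: "disjoint_family_on A I" "disjoint_family_on B J"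
    and eq: "(\<Union>i\<in>I. A i) = (\<Union>j\<in>J. B j)"
  shows "(\<Sum>i\<in>I. (-1) ^ nat (aff_dim (A i))) = (\<Sum>j\<in>J. (-1) ^ nat (aff_dim (B j)) :: int)"
proof -
  define C where "C = case_sum A B"
  define c :: "'i + 'j \<Rightarrow> int" where "c = case_sum (\<lambda>_. 1) (\<lambda>_. - 1)"
  have "(\<Sum>k\<in>I <+> J. c k * (-1) ^ nat (aff_dim (C k))) = 0"
  proof (rule euler_relation)
    show "finite (I <+> J)" using fin by simp
    show "convex (C k) \<and> bounded (C k) \<and> rel_open (C k) \<and> C k \<noteq> {}" if "k \<in> I <+> J" for k
      using that A B by (auto simp: C_def)
    show "(\<Sum>k\<in>{k \<in> I <+> J. x \<in> C k}. c k) = 0" for x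
    proof (cases "x \<in> (\<Union>i\<in>I. A i)")
      case True
      then obtain i j where ij: "i \<in> I" "x \<in> A i" "j \<in> J" "x \<in> B j" using eq by blast
      have I: "x \<in> A i' \<longleftrightarrow> i' = i" if "i' \<in> I" for i'
        using disjoint_family_onD[OF disj(1) that ij(1)] ij(2) by blast
      have J: "x \<in> B j' \<longleftrightarrow> j' = j" if "j' \<in> J" for j'
        using disjoint_family_onD[OF disj(2) that ij(3)] ij(4) by blast
      have "{k \<in> I <+> J. x \<in> C k} = {Inl i, Inr j}"
        by (auto simp: C_def I J ij(1,3))
      then show ?thesis by (simp add: c_def)
    next
      case False
      then have "x \<notin> (\<Union>j\<in>J. B j)" using eq by simp
      with False have "{k \<in> I <+> J. x \<in> C k} = {}" by (auto simp: C_def)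
      then show ?thesis by (simp only: sum.empty)
    qed
  qed
  then show ?thesis
    using fin by (simp add: sum.Plus C_def c_def sum_negf)
qed

text \<open>Cutting with an open convex set keeps cells convex and relatively open and does not
  change the dimension of those it meets, so both families restrict to partitions of the same
  smaller set.\<close>

lemma euler_partition_Int_open:
  fixes A :: "'i \<Rightarrow> 'a::euclidean_space set" and B :: "'j \<Rightarrow> 'a set"
  assumes fin: "finite I" "finite J"
    and A: "\<And>i. i \<in> I \<Longrightarrow> convex (A i) \<and> bounded (A i) \<and> rel_open (A i) \<and> A i \<noteq> {}"
    and B: "\<And>j. j \<in> J \<Longrightarrow> convex (B j) \<and> bounded (B j) \<and> rel_open (B j) \<and> B j \<noteq> {}"
    and disj: "disjoint_family_on A I" "disjoint_family_on B J"
    and eq: "(\<Union>i\<in>I. A i) = (\<Union>j\<in>J. B j)"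
    and U: "open U" "convex U"
  shows "(\<Sum>i\<in>{i\<in>I. A i \<inter> U \<noteq> {}}. (-1) ^ nat (aff_dim (A i))) =
         (\<Sum>j\<in>{j\<in>J. B j \<inter> U \<noteq> {}}. (-1) ^ nat (aff_dim (B j)) :: int)"
proof -
  have cell: "convex (C \<inter> U) \<and> bounded (C \<inter> U) \<and> rel_open (C \<inter> U)"
    if "convex C \<and> bounded C \<and> rel_open C \<and> C \<noteq> {}" "C \<inter> U \<noteq> {}" for C :: "'a set"
    using that U convex_rel_interior_inter_two[of C U]
    by (auto simp: convex_Int bounded_Int rel_open_def rel_interior_open)
  let ?I = "{i\<in>I. A i \<inter> U \<noteq> {}}" and ?J = "{j\<in>J. B j \<inter> U \<noteq> {}}"
  have "(\<Sum>i\<in>?I. (-1) ^ nat (aff_dim (A i \<inter> U))) = (\<Sum>j\<in>?J. (-1) ^ nat (aff_dim (B j \<inter> U)) :: int)"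
  proof (rule euler_partition)
    show "(\<Union>i\<in>?I. A i \<inter> U) = (\<Union>j\<in>?J. B j \<inter> U)"
      using eq by blast
    show "disjoint_family_on (\<lambda>i. A i \<inter> U) ?I" "disjoint_family_on (\<lambda>j. B j \<inter> U) ?J"
      using disj by (fastforce simp: disjoint_family_on_def)+
  qed (use fin cell A B in auto)
  moreover have "(\<Sum>i\<in>?I. (-1) ^ nat (aff_dim (A i \<inter> U))) = (\<Sum>i\<in>?I. (-1) ^ nat (aff_dim (A i)) :: int)"
    using A U by (intro sum.cong refl) (simp add: aff_dim_convex_Int_open)
  moreover have "(\<Sum>j\<in>?J. (-1) ^ nat (aff_dim (B j \<inter> U))) = (\<Sum>j\<in>?J. (-1) ^ nat (aff_dim (B j)) :: int)"
    using B U by (intro sum.cong refl) (simp add: aff_dim_convex_Int_open)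
  ultimately show ?thesis by metis
qed

text \<open>A small ball around \<open>y\<close> meets exactly the cells that have \<open>y\<close>
  in their closure. The sum is thus a local Euler number at \<open>y\<close> that depends on the set
  alone.\<close>

lemma euler_partition_closure:
  fixes A :: "'i \<Rightarrow> 'a::euclidean_space set" and B :: "'j \<Rightarrow> 'a set"
  assumes fin: "finite I" "finite J"
    and A: "\<And>i. i \<in> I \<Longrightarrow> convex (A i) \<and> bounded (A i) \<and> rel_open (A i) \<and> A i \<noteq> {}"
    and B: "\<And>j. j \<in> J \<Longrightarrow> convex (B j) \<and> bounded (B j) \<and> rel_open (B j) \<and> B j \<noteq> {}"
    and disj: "disjoint_family_on A I" "disjoint_family_on B J"
    and eq: "(\<Union>i\<in>I. A i) = (\<Union>j\<in>J. B j)"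
  shows "(\<Sum>i\<in>{i\<in>I. y \<in> closure (A i)}. (-1) ^ nat (aff_dim (A i))) =
         (\<Sum>j\<in>{j\<in>J. y \<in> closure (B j)}. (-1) ^ nat (aff_dim (B j)) :: int)"
proof -
  have ev: "\<forall>\<^sub>F e in at_right 0. C \<inter> ball y e \<noteq> {} \<longleftrightarrow> y \<in> closure C" for C
  proof (cases "y \<in> closure C")
    case True
    then have "\<forall>\<^sub>F e in at_right (0::real). C \<inter> ball y e \<noteq> {}"
      unfolding closure_approachable eventually_at_right_field
      by (intro exI[of _ 1]) (auto simp: disjoint_iff dist_commute)
    then show ?thesis using True by simp
  next
    case False
    then obtain e where "e > 0" "\<forall>z\<in>C. e \<le> dist z y"
      unfolding closure_approachable by (auto simp: not_less)
    then have "\<forall>\<^sub>F e in at_right (0::real). C \<inter> ball y e = {}"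
      unfolding eventually_at_right_field
      by (intro exI[of _ e]) (force simp: disjoint_iff dist_commute)
    then show ?thesis using False by simp
  qed
  have "\<forall>\<^sub>F e in at_right 0. (\<forall>i\<in>I. A i \<inter> ball y e \<noteq> {} \<longleftrightarrow> y \<in> closure (A i)) \<and>
      (\<forall>j\<in>J. B j \<inter> ball y e \<noteq> {} \<longleftrightarrow> y \<in> closure (B j))"
    \<comment> \<open>Finiteness of both families allows one radius for all cells.\<close>
    using fin by (intro eventually_conj eventually_ball_finite ballI ev)
  then obtain e where e: "\<forall>i\<in>I. A i \<inter> ball y e \<noteq> {} \<longleftrightarrow> y \<in> closure (A i)"
      "\<forall>j\<in>J. B j \<inter> ball y e \<noteq> {} \<longleftrightarrow> y \<in> closure (B j)"
    using eventually_happens'[OF trivial_limit_at_right_real] by blast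
  have "{i\<in>I. A i \<inter> ball y e \<noteq> {}} = {i\<in>I. y \<in> closure (A i)}"
    "{j\<in>J. B j \<inter> ball y e \<noteq> {}} = {j\<in>J. y \<in> closure (B j)}"
    using e by blast+
  then show ?thesis
    using euler_partition_Int_open[OF fin A B disj eq open_ball[of y e] convex_ball[of y e]] by simp
qed

text \<open>A face of \<open>K\<close> that meets the relative interior of \<open>K\<close> is
  \<open>K\<close> itself; apply this to the common face of two simplices from both sides.\<close>

lemma simplicial_complex_disjoint_rel_interiors:
  assumes "simplicial_complex \<K>"
  shows "disjoint_family_on rel_interior \<K>"
proof -
  have "K = L" if "K \<in> \<K>" "L \<in> \<K>" "x \<in> rel_interior K" "x \<in> rel_interior L" for K L x
  proof -
    have "(K \<inter> L) face_of K" "(L \<inter> K) face_of L"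
      using assms that(1,2) unfolding simplicial_complex_def by blast+
    moreover have "x \<in> K \<inter> L" using that rel_interior_subset by blast
    ultimately have "K \<inter> L = K" "L \<inter> K = L"
      using that(3,4) face_of_disjoint_rel_interior by blast+
    then show ?thesis by blast
  qed
  then show ?thesis by (auto simp: disjoint_family_on_def)
qed

text \<open>A minimal simplex containing a point has it in its relative interior, since otherwise a
  proper face would contain it too.\<close>

lemma simplicial_complex_Union_rel_interiors:
  fixes \<K> :: "'a::euclidean_space set set"
  assumes "simplicial_complex \<K>"
  shows "(\<Union>K\<in>\<K>. rel_interior K) = \<Union>\<K>"
proof
  show "\<Union>\<K> \<subseteq> (\<Union>K\<in>\<K>. rel_interior K)"
  proof
    fix x assume "x \<in> \<Union>\<K>"
    then have "{K\<in>\<K>. x \<in> K} \<noteq> {}" "finite {K\<in>\<K>. x \<in> K}"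
      using assms by (auto simp: simplicial_complex_def)
    then obtain K where K: "K \<in> \<K>" "x \<in> K" and min: "\<And>L. \<lbrakk>L \<in> \<K>; x \<in> L; L \<subseteq> K\<rbrakk> \<Longrightarrow> L = K"
      using finite_has_minimal[of "{K\<in>\<K>. x \<in> K}"] by auto
    have "polyhedron K"
      using assms K(1) simplex_imp_polyhedron unfolding simplicial_complex_def by blast
    have "x \<in> rel_interior K"
    proof (rule ccontr)
      assume "x \<notin> rel_interior K"
      then have "x \<in> rel_frontier K"
        using K(2) closure_subset by (auto simp: rel_frontier_def)
      then obtain F where "F face_of K" "F \<noteq> K" "x \<in> F"
        using rel_frontier_of_polyhedron_alt[OF \<open>polyhedron K\<close>] by blast
      then show False
        using min[of F] assms K(1) face_of_imp_subset unfolding simplicial_complex_def by blast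
    qed
    then show "x \<in> (\<Union>K\<in>\<K>. rel_interior K)" using K(1) by blast
  qed
qed (use rel_interior_subset in blast)

lemma rel_interior_affine_image:
  fixes f :: "'a::euclidean_space \<Rightarrow> 'b::euclidean_space"
  assumes "linear h" "\<forall>x\<in>K. f x = h x + c" "convex K"
  shows "convex (f ` K)" "f ` rel_interior K = rel_interior (f ` K)" "continuous_on K f" "aff_dim (f ` K) \<le> aff_dim K"
proof -
  have im: "f ` L = (+) c ` h ` L" if "L \<subseteq> K" for L
    unfolding image_image using that assms(2) by (intro image_cong) (auto simp: add.commute)
  show "convex (f ` K)"
    using im[of K] assms by (simp add: convex_linear_image convex_translation)
  show "f ` rel_interior K = rel_interior (f ` K)"
    using im[of K] im[of "rel_interior K"] assms
    by (simp add: rel_interior_subset rel_interior_convex_linear_image rel_interior_translation)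
  have "continuous_on K (\<lambda>x. h x + c)"
    by (intro continuous_on_add continuous_on_const linear_continuous_on)
      (use assms(1) linear_conv_bounded_linear in blast)
  then show "continuous_on K f"
    using assms(2) by (simp cong: continuous_on_cong)
  show "aff_dim (f ` K) \<le> aff_dim K"
    using im[of K] assms(1) by (simp add: aff_dim_translation_eq aff_dim_linear_image_le)
qed

text \<open>Images of open simplices are admissible cells for the Euler relation. An affine map
  cannot raise dimension, and injectivity with invariance of dimension excludes a drop.\<close>

lemma euler_cells_affine_images:
  fixes f :: "'a::euclidean_space \<Rightarrow> 'b::euclidean_space"
  assumes \<K>: "simplicial_complex \<K>"
    and aff: "\<forall>K\<in>\<K>. \<exists>h c. linear h \<and> (\<forall>x\<in>K. f x = h x + c)"
    and inj: "inj_on f (\<Union>\<K>)" and K: "K \<in> \<K> - {{}}"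
  shows "convex (f ` rel_interior K) \<and> bounded (f ` rel_interior K) \<and> rel_open (f ` rel_interior K)
      \<and> f ` rel_interior K \<noteq> {}"
    and "aff_dim (f ` rel_interior K) = aff_dim K"
    and "closure (f ` rel_interior K) = f ` K"
proof -
  obtain n where "n simplex K" using \<K> K unfolding simplicial_complex_def by blast
  then have KK: "convex K" "compact K" "K \<noteq> {}"
    using K by (auto simp: convex_simplex compact_simplex)
  obtain h c where "linear h" "\<forall>x\<in>K. f x = h x + c" using aff K by blast
  note f = rel_interior_affine_image[OF this(1) this(2) KK(1)]
  have "compact (f ` K)" using f(3) KK(2) by (rule compact_continuous_image)
  then have "closed (f ` K)" "bounded (f ` K)" by (auto simp: compact_imp_closed compact_imp_bounded)
  moreover have "rel_interior (f ` K) \<noteq> {}"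
    using rel_interior_eq_empty[OF f(1)] KK(3) by simp
  ultimately show "convex (f ` rel_interior K) \<and> bounded (f ` rel_interior K) \<and> rel_open (f ` rel_interior K)
      \<and> f ` rel_interior K \<noteq> {}"
    unfolding f(2) using convex_rel_interior[OF f(1)] rel_interior_rel_open[OF f(1)]
      bounded_subset[OF \<open>bounded (f ` K)\<close> rel_interior_subset] by blast
  show "closure (f ` rel_interior K) = f ` K"
    unfolding f(2) using convex_closure_rel_interior[OF f(1)] \<open>closed (f ` K)\<close> by simp
  have "inj_on f K" using inj by (rule inj_on_subset) (use K in auto)
  then have "aff_dim K \<le> aff_dim (f ` K)"
    using f(3) KK(1) by (intro invariance_of_dimension_convex_domain[of K f "f ` K"]) (auto simp: hull_inc)
  then show "aff_dim (f ` rel_interior K) = aff_dim K"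
    unfolding f(2) using f(1,4) by (simp add: rel_interior_aff_dim)
qed

text \<open>The images of the open simplices of \<open>\<K>\<close> and the open simplices of
  \<open>\<L>\<close> are two partitions of the same set into convex cells, so global and local
  Euler numbers agree although the partitions may cross each other arbitrarily.\<close>

lemma simplicial_complex_euler_invariance:
  fixes f :: "'a::euclidean_space \<Rightarrow> 'b::euclidean_space"
  assumes \<K>: "simplicial_complex \<K>" and \<L>: "simplicial_complex \<L>"
    and aff: "\<forall>K\<in>\<K>. \<exists>h c. linear h \<and> (\<forall>x\<in>K. f x = h x + c)"
    and inj: "inj_on f (\<Union>\<K>)" and im: "f ` \<Union>\<K> = \<Union>\<L>"
  shows "(\<Sum>K\<in>\<K> - {{}}. (-1) ^ nat (aff_dim K)) = (\<Sum>L\<in>\<L> - {{}}. (-1) ^ nat (aff_dim L) :: int)"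
    and "x \<in> \<Union>\<K> \<Longrightarrow> (\<Sum>K\<in>{K\<in>\<K>. x \<in> K}. (-1) ^ nat (aff_dim K)) =
                         (\<Sum>L\<in>{L\<in>\<L>. f x \<in> L}. (-1) ^ nat (aff_dim L) :: int)"
proof -
  have id_aff: "\<forall>L\<in>\<L>. \<exists>h c. linear h \<and> (\<forall>x\<in>L. id x = h x + c)"
    \<comment> \<open>Viewing \<open>\<L>\<close> as its own image under \<open>id\<close> makes the
      cell lemma serve both families.\<close>
    by (rule ballI, rule exI[of _ id], rule exI[of _ 0]) (simp add: linear_id)
  note A = euler_cells_affine_images[OF \<K> aff inj]
  note B = euler_cells_affine_images[OF \<L> id_aff inj_on_id, unfolded image_id id_apply]
  let ?A = "\<lambda>K. f ` rel_interior K"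
  \<comment> \<open>The empty simplex has to go: it is no cell, and as \<open>nat (-1) = 0\<close>
    it would contribute 1.\<close>
  have fin: "finite (\<K> - {{}})" "finite (\<L> - {{}})"
    using \<K> \<L> by (auto simp: simplicial_complex_def)
  have "disjoint_family_on ?A \<K>"
    unfolding disjoint_family_on_def
  proof (intro ballI impI)
    fix K L assume KL: "K \<in> \<K>" "L \<in> \<K>" "K \<noteq> L"
    have "rel_interior K \<subseteq> \<Union>\<K>" "rel_interior L \<subseteq> \<Union>\<K>"
      using KL rel_interior_subset by blast+
    then have "?A K \<inter> ?A L = f ` (rel_interior K \<inter> rel_interior L)"
      using inj by (simp add: inj_on_image_Int)
    also have "rel_interior K \<inter> rel_interior L = {}"
      using simplicial_complex_disjoint_rel_interiors[OF \<K>] KL by (simp add: disjoint_family_on_def)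
    finally show "?A K \<inter> ?A L = {}" by simp
  qed
  then have disj: "disjoint_family_on ?A (\<K> - {{}})" "disjoint_family_on rel_interior (\<L> - {{}})"
    using simplicial_complex_disjoint_rel_interiors[OF \<L>]
    by (auto intro: disjoint_family_on_mono[rotated])
  have "(\<Union>K\<in>\<K> - {{}}. ?A K) = f ` (\<Union>K\<in>\<K>. rel_interior K)"
    by (force simp: image_Union)
  also have "\<dots> = (\<Union>L\<in>\<L>. rel_interior L)"
    using im by (simp add: simplicial_complex_Union_rel_interiors[OF \<K>] simplicial_complex_Union_rel_interiors[OF \<L>])
  also have "\<dots> = (\<Union>L\<in>\<L> - {{}}. rel_interior L)" by force
  finally have un: "(\<Union>K\<in>\<K> - {{}}. ?A K) = (\<Union>L\<in>\<L> - {{}}. rel_interior L)" .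
  show "(\<Sum>K\<in>\<K> - {{}}. (-1) ^ nat (aff_dim K)) = (\<Sum>L\<in>\<L> - {{}}. (-1) ^ nat (aff_dim L) :: int)"
    using euler_partition[OF fin A(1) B(1) disj un] by (simp add: A(2) B(2))
  show "(\<Sum>K\<in>{K\<in>\<K>. x \<in> K}. (-1) ^ nat (aff_dim K)) =
        (\<Sum>L\<in>{L\<in>\<L>. f x \<in> L}. (-1) ^ nat (aff_dim L) :: int)" if x: "x \<in> \<Union>\<K>"
  proof -
    \<comment> \<open>By injectivity the local count of closures at \<open>f x\<close> is a count of
      the simplices containing \<open>x\<close>.\<close>
    have "f x \<in> closure (?A K) \<longleftrightarrow> x \<in> K" if "K \<in> \<K> - {{}}" for K
      unfolding A(3)[OF that] using inj_on_image_mem_iff[OF inj x, of K] that by blast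
    then have "{K \<in> \<K> - {{}}. f x \<in> closure (?A K)} = {K\<in>\<K>. x \<in> K}"
      by auto
    moreover have "f x \<in> closure (rel_interior L) \<longleftrightarrow> f x \<in> L" if "L \<in> \<L> - {{}}" for L
      using B(3)[OF that] by simp
    then have "{L \<in> \<L> - {{}}. f x \<in> closure (rel_interior L)} = {L\<in>\<L>. f x \<in> L}"
      by auto
    moreover have "(\<Sum>K\<in>{K\<in>\<K>. x \<in> K}. (-1) ^ nat (aff_dim (?A K))) = (\<Sum>K\<in>{K\<in>\<K>. x \<in> K}. (-1) ^ nat (aff_dim K) :: int)"
    proof (rule sum.cong[OF refl])
      fix K assume "K \<in> {K\<in>\<K>. x \<in> K}"
      then have "K \<in> \<K> - {{}}" by blast
      from A(2)[OF this] show "(-1) ^ nat (aff_dim (?A K)) = ((-1) ^ nat (aff_dim K) :: int)"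
        by (rule arg_cong)
    qed
    moreover have "(\<Sum>L\<in>{L\<in>\<L>. f x \<in> L}. (-1) ^ nat (aff_dim (rel_interior L))) = (\<Sum>L\<in>{L\<in>\<L>. f x \<in> L}. (-1) ^ nat (aff_dim L) :: int)"
    proof (rule sum.cong[OF refl])
      fix L assume "L \<in> {L\<in>\<L>. f x \<in> L}"
      then have "L \<in> \<L> - {{}}" by blast
      from B(2)[OF this] show "(-1) ^ nat (aff_dim (rel_interior L)) = ((-1) ^ nat (aff_dim L) :: int)"
        by (rule arg_cong)
    qed
    ultimately show ?thesis
      using euler_partition_closure[OF fin A(1) B(1) disj un, of "f x"] by simp
  qed
qed

section \<open>Simplicial complexes and induced triangulations\<close>

lemma support_Union: "support \<rho> S = \<Union>((\<lambda>F. convex hull (\<rho> ` F)) ` S)"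
  by (simp add: support_def)

lemma support_Pow: "support r (Pow T) = convex hull (r ` T)"
  unfolding support_def using hull_mono[of "r ` _" "r ` T" convex] by blast

context
  fixes \<rho> :: "'v \<Rightarrow> 'a::euclidean_space" and S :: "'v set set"
  assumes complex: "abstract_complex S" and realization: "geometric_realization \<rho> S"
begin

lemma card_image_face: "F \<in> S \<Longrightarrow> card (\<rho> ` F) = card F"
  using realization unfolding geometric_realization_def
  by (meson Union_upper card_image inj_on_subset)

lemma aff_dim_face: "F \<in> S \<Longrightarrow> aff_dim (convex hull (\<rho> ` F)) = int (card F) - 1"
  using realization card_image_face aff_dim_affine_independent[of "\<rho> ` F"]
  by (auto simp: geometric_realization_def aff_dim_convex_hull)

text \<open>Translates incidence of points into inclusion of vertex sets. If \<open>x\<close> lies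
  in the hull of \<open>G\<close>, the common face of both hulls contains a relative interior point
  of the hull of \<open>H\<close>, hence is all of it; so the hull of \<open>H\<close> is a face of
  that of \<open>G\<close>, and extreme points are inherited.\<close>

lemma rel_interior_face_mem_iff:
  assumes "H \<in> S" "G \<in> S" and x: "x \<in> rel_interior (convex hull (\<rho> ` H))"
  shows "x \<in> convex hull (\<rho> ` G) \<longleftrightarrow> H \<subseteq> G"
proof
  let ?h = "\<lambda>F. convex hull (\<rho> ` F)"
  assume "x \<in> ?h G"
  have faces: "(?h H \<inter> ?h G) face_of ?h H" "(?h G \<inter> ?h H) face_of ?h G"
    using realization assms(1,2) by (auto simp: geometric_realization_def simplicial_complex_def)
  have ind: "\<not> affine_dependent (\<rho> ` H)" "\<not> affine_dependent (\<rho> ` G)"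
    using realization assms(1,2) by (auto simp: geometric_realization_def)
  have "?h H \<inter> ?h G = ?h H"
    using face_of_disjoint_rel_interior[OF faces(1)] x \<open>x \<in> ?h G\<close> rel_interior_subset by blast
  then have "?h H face_of ?h G"
    using faces(2) by (simp add: Int_commute)
  then have "y extreme_point_of ?h H \<Longrightarrow> y extreme_point_of ?h G" for y
    using extreme_point_of_face by blast
  then have "\<rho> ` H \<subseteq> \<rho> ` G"
    by (auto simp: extreme_point_of_convex_hull_affine_independent ind)
  moreover have "inj_on \<rho> (vert S)" "H \<subseteq> vert S" "G \<subseteq> vert S"
    using realization assms(1,2) by (auto simp: geometric_realization_def)
  ultimately show "H \<subseteq> G"
    by (simp add: inj_on_image_subset_iff)
next
  assume "H \<subseteq> G"
  then have "convex hull (\<rho> ` H) \<subseteq> convex hull (\<rho> ` G)"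
    by (intro hull_mono image_mono)
  then show "x \<in> convex hull (\<rho> ` G)"
    using x rel_interior_subset by blast
qed

lemma vertex_mem_hull_iff:
  assumes "v \<in> vert S" "G \<in> S"
  shows "\<rho> v \<in> convex hull (\<rho> ` G) \<longleftrightarrow> v \<in> G"
proof -
  have "{v} \<in> S" using complex assms(1) unfolding abstract_complex_def by blast
  then show ?thesis
    using rel_interior_face_mem_iff[of "{v}" G "\<rho> v"] assms(2) by simp
qed

lemma inj_on_hull: "inj_on (\<lambda>F. convex hull (\<rho> ` F)) S"
proof (rule inj_onI)
  fix F G assume FG: "F \<in> S" "G \<in> S" "convex hull (\<rho> ` F) = convex hull (\<rho> ` G)"
  show "F = G"
  proof
    show "F \<subseteq> G" using vertex_mem_hull_iff[OF _ FG(2)] FG hull_inc[of _ "\<rho> ` F"] by blast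
    show "G \<subseteq> F" using vertex_mem_hull_iff[OF _ FG(1)] FG hull_inc[of _ "\<rho> ` G"] by blast
  qed
qed

lemma euler_hulls:
  "(\<Sum>L\<in>(\<lambda>F. convex hull (\<rho> ` F)) ` S - {{}}. (-1) ^ nat (aff_dim L)) =
     (\<Sum>F\<in>S - {{}}. (-1) ^ (card F - 1) :: int)"
  "(\<Sum>L\<in>{L \<in> (\<lambda>F. convex hull (\<rho> ` F)) ` S. y \<in> L}. (-1) ^ nat (aff_dim L)) =
     (\<Sum>F\<in>{F \<in> S. y \<in> convex hull (\<rho> ` F)}. (-1) ^ (card F - 1) :: int)"
proof -
  let ?h = "\<lambda>F. convex hull (\<rho> ` F)"
  \<comment> \<open>This covers the empty face as well: both exponents truncate to 0.\<close>
  have dim: "(-1) ^ nat (aff_dim (?h F)) = ((-1) ^ (card F - 1) :: int)" if "F \<in> S" for F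
    using aff_dim_face[OF that] by (simp add: nat_diff_distrib')
  have reindex: "(\<Sum>L\<in>?h ` R. (-1) ^ nat (aff_dim L)) = (\<Sum>F\<in>R. (-1) ^ (card F - 1) :: int)" if "R \<subseteq> S" for R
    using that dim by (subst sum.reindex) (auto intro!: sum.cong inj_on_subset[OF inj_on_hull])
  have "?h ` S - {{}} = ?h ` (S - {{}})" by auto
  then show "(\<Sum>L\<in>?h ` S - {{}}. (-1) ^ nat (aff_dim L)) = (\<Sum>F\<in>S - {{}}. (-1) ^ (card F - 1) :: int)"
    using reindex[of "S - {{}}"] by simp
  have "{L \<in> ?h ` S. y \<in> L} = ?h ` {F \<in> S. y \<in> ?h F}" by auto
  then show "(\<Sum>L\<in>{L \<in> ?h ` S. y \<in> L}. (-1) ^ nat (aff_dim L)) =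
     (\<Sum>F\<in>{F \<in> S. y \<in> ?h F}. (-1) ^ (card F - 1) :: int)"
    using reindex[of "{F \<in> S. y \<in> ?h F}"] by simp
qed

end

section \<open>Alternating sums over the faces of a simplex\<close>

lemma sum_Pow_alternating:
  assumes "finite A" "A \<noteq> {}"
  shows "(\<Sum>D\<in>Pow A. (-1) ^ card D :: int) = 0"
proof -
  \<comment> \<open>The subsets avoiding \<open>a\<close> are matched with those containing it;
    matched signs are opposite.\<close>
  obtain a B where A: "A = insert a B" "a \<notin> B" using assms(2) by (metis Set.set_insert all_not_in_conv)
  then have "finite B" using assms(1) by simp
  have card: "card (insert a D) = Suc (card D)" if "D \<in> Pow B" for D
    using that A(2) \<open>finite B\<close> by (auto intro!: card_insert_disjoint dest: finite_subset)
  have "inj_on (insert a) (Pow B)" using A(2) by (auto simp: inj_on_def)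
  then have "(\<Sum>D\<in>insert a ` Pow B. (-1) ^ card D :: int) = (\<Sum>D\<in>Pow B. - ((-1) ^ card D))"
    by (subst sum.reindex) (auto intro!: sum.cong simp: card)
  moreover have "Pow A = Pow B \<union> insert a ` Pow B" by (simp add: A(1) Pow_insert)
  moreover have "Pow B \<inter> insert a ` Pow B = {}" using A(2) by auto
  ultimately show ?thesis
    using \<open>finite B\<close> by (simp add: sum.union_disjoint sum_negf)
qed

text \<open>The alternating sum over all subsets vanishes, so the nonempty ones balance the empty
  set; the shifted exponent flips the sign.\<close>

lemma euler_simplex:
  assumes "finite T" "T \<noteq> {}"
  shows "(\<Sum>G\<in>Pow T - {{}}. (-1) ^ (card G - 1) :: int) = 1"
proof -
  have "(\<Sum>G\<in>Pow T. (-1) ^ card G :: int) = 1 + (\<Sum>G\<in>Pow T - {{}}. (-1) ^ card G)"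
    using assms(1) by (subst sum.remove[of _ "{}"]) auto
  moreover have "(-1) ^ card G = - ((-1) ^ (card G - 1) :: int)" if "G \<in> Pow T - {{}}" for G
    using that assms(1) by (cases "card G") (auto dest: finite_subset)
  ultimately show ?thesis
    using sum_Pow_alternating[OF assms] by (simp add: sum_negf)
qed

text \<open>Write a face containing \<open>H\<close> as \<open>H\<close> together with some
  \<open>D\<close> in \<open>T - H\<close>: the sum factors through the alternating sum over these
  \<open>D\<close>, which vanishes unless \<open>H = T\<close>. This is what separates interior from
  boundary points.\<close>

lemma euler_simplex_star:
  assumes "finite T" "H \<subseteq> T" "H \<noteq> {}"
  shows "(\<Sum>G\<in>{G \<in> Pow T. H \<subseteq> G}. (-1) ^ (card G - 1) :: int) = (if H = T then (-1) ^ (card T - 1) else 0)"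
proof -
  have "{G \<in> Pow T. H \<subseteq> G} = (\<lambda>D. H \<union> D) ` Pow (T - H)"
  proof (intro equalityI subsetI)
    fix G assume "G \<in> {G \<in> Pow T. H \<subseteq> G}"
    then show "G \<in> (\<lambda>D. H \<union> D) ` Pow (T - H)" by (intro image_eqI[of _ _ "G - H"]) auto
  qed (use assms(2) in auto)
  moreover have "inj_on (\<lambda>D. H \<union> D) (Pow (T - H))" by (auto simp: inj_on_def)
  moreover have "card (H \<union> D) - 1 = (card H - 1) + card D" if "D \<in> Pow (T - H)" for D
  proof -
    have fin: "finite H" "finite D" using assms that by (auto dest: finite_subset)
    then have "card (H \<union> D) = card H + card D" using that by (intro card_Un_disjoint) auto
    moreover have "card H \<noteq> 0" using assms(3) fin by simp
    ultimately show ?thesis by simp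
  qed
  ultimately have "(\<Sum>G\<in>{G \<in> Pow T. H \<subseteq> G}. (-1) ^ (card G - 1) :: int) =
      (-1) ^ (card H - 1) * (\<Sum>D\<in>Pow (T - H). (-1) ^ card D)"
    by (simp add: sum.reindex sum_distrib_left power_add)
  then show ?thesis
    using sum_Pow_alternating[of "T - H"] assms by auto
qed

section \<open>Euler numbers of an induced triangulation\<close>

context
  fixes T :: "'t set" and r :: "'t \<Rightarrow> 'a::euclidean_space"
    and S :: "'v set set" and \<rho> :: "'v \<Rightarrow> 'e::euclidean_space" and \<phi> :: "'a \<Rightarrow> 'e"
  assumes triangulation: "induced_triangulation T r S \<rho> \<phi>"
begin

lemma triangulation_complexes:
  "abstract_complex (Pow T)" "geometric_realization r (Pow T)" "finite T"
  "abstract_complex S" "geometric_realization \<rho> S" "finite S" "finite (vert S)"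
  using triangulation by (auto simp: induced_triangulation_def abstract_complex_def)

lemma triangulation_homeomorphism: "\<exists>g. homeomorphism (convex hull (r ` T)) (support \<rho> S) \<phi> g"
  using triangulation unfolding induced_triangulation_def pl_homeomorphism_def support_Pow by blast

lemma triangulation_inj: "inj_on \<phi> (convex hull (r ` T))"
proof -
  obtain g where "homeomorphism (convex hull (r ` T)) (support \<rho> S) \<phi> g"
    using triangulation_homeomorphism by blast
  then show ?thesis by (intro inj_on_inverseI[of _ g]) (rule homeomorphism_apply1)
qed

lemma triangulation_image: "\<phi> ` (convex hull (r ` T)) = support \<rho> S"
  using triangulation_homeomorphism homeomorphism_image1 by blast

lemma simplex_face_subset: "F \<subseteq> T \<Longrightarrow> convex hull (r ` F) \<subseteq> convex hull (r ` T)"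
  by (intro hull_mono image_mono)

text \<open>The inverse homeomorphism embeds the hull of \<open>F\<close> into the simplex, so
  invariance of dimension applies. For a tetrahedron only the face numbers in dimensions 0 to 3
  remain to be counted.\<close>

lemma card_face_le:
  assumes "F \<in> S"
  shows "card F \<le> card T"
proof -
  obtain g where g: "homeomorphism (convex hull (r ` T)) (support \<rho> S) \<phi> g"
    using triangulation_homeomorphism by blast
  let ?C = "convex hull (\<rho> ` F)"
  have C: "?C \<subseteq> support \<rho> S" using assms by (auto simp: support_def)
  have "aff_dim ?C \<le> aff_dim (convex hull (r ` T))"
  proof (rule invariance_of_dimension_convex_domain)
    show "continuous_on ?C g" using g C by (meson continuous_on_subset homeomorphism_cont2)
    show "g \<in> ?C \<rightarrow> affine hull (convex hull (r ` T))"
      using homeomorphism_image2[OF g] C hull_subset[of "convex hull (r ` T)" affine] by blast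
    show "inj_on g ?C" using homeomorphism_apply2[OF g] C by (intro inj_on_inverseI[of _ \<phi>]) blast
  qed (rule convex_convex_hull)
  then show ?thesis
    using aff_dim_face[OF triangulation_complexes(4,5) assms]
      aff_dim_face[OF triangulation_complexes(1,2), of T] by simp
qed

text \<open>The subdivision on which \<open>\<phi>\<close> is affine mediates: the identity compares
  it with the face complex of the simplex, \<open>\<phi>\<close> compares it with
  \<open>S\<close>.\<close>

lemma triangulation_euler_transfer:
  "(\<Sum>F\<in>S - {{}}. (-1) ^ (card F - 1)) = (\<Sum>G\<in>Pow T - {{}}. (-1) ^ (card G - 1) :: int)"
  "x \<in> convex hull (r ` T) \<Longrightarrow> (\<Sum>F\<in>{F \<in> S. \<phi> x \<in> convex hull (\<rho> ` F)}. (-1) ^ (card F - 1)) =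
    (\<Sum>G\<in>{G \<in> Pow T. x \<in> convex hull (r ` G)}. (-1) ^ (card G - 1) :: int)"
proof -
  obtain \<K> where \<K>: "simplicial_complex \<K>" "\<Union>\<K> = convex hull (r ` T)"
      and aff: "\<forall>K\<in>\<K>. \<exists>h c. linear h \<and> (\<forall>x\<in>K. \<phi> x = h x + c)"
    using triangulation
    unfolding induced_triangulation_def pl_homeomorphism_def piecewise_linear_on_def support_Pow by blast
  have id_aff: "\<forall>K\<in>\<K>. \<exists>h c. linear h \<and> (\<forall>x\<in>K. id x = h x + c)"
    by (rule ballI, rule exI[of _ id], rule exI[of _ 0]) (simp add: linear_id)
  have com: "simplicial_complex ((\<lambda>F. convex hull (r ` F)) ` Pow T)"
    "simplicial_complex ((\<lambda>F. convex hull (\<rho> ` F)) ` S)"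
    using triangulation_complexes by (auto simp: geometric_realization_def)
  have inj: "inj_on \<phi> (\<Union>\<K>)" using triangulation_inj \<K>(2) by simp
  have im: "id ` \<Union>\<K> = \<Union>((\<lambda>F. convex hull (r ` F)) ` Pow T)"
      "\<phi> ` \<Union>\<K> = \<Union>((\<lambda>F. convex hull (\<rho> ` F)) ` S)"
    using triangulation_image support_Pow[of r T] by (auto simp: \<K>(2) support_Union)
  note source = simplicial_complex_euler_invariance[OF \<K>(1) com(1) id_aff inj_on_id im(1)]
  note target = simplicial_complex_euler_invariance[OF \<K>(1) com(2) aff inj im(2)]
  note source_hulls = euler_hulls[OF triangulation_complexes(1,2)]
  note target_hulls = euler_hulls[OF triangulation_complexes(4,5)]
  show "(\<Sum>F\<in>S - {{}}. (-1) ^ (card F - 1)) = (\<Sum>G\<in>Pow T - {{}}. (-1) ^ (card G - 1) :: int)"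
    using source(1) target(1) unfolding source_hulls target_hulls by simp
  show "(\<Sum>F\<in>{F \<in> S. \<phi> x \<in> convex hull (\<rho> ` F)}. (-1) ^ (card F - 1)) =
    (\<Sum>G\<in>{G \<in> Pow T. x \<in> convex hull (r ` G)}. (-1) ^ (card G - 1) :: int)"
    if "x \<in> convex hull (r ` T)"
    using source(2)[of x] target(2)[of x] that unfolding \<K>(2) source_hulls target_hulls by simp
qed

lemma triangulation_euler:
  assumes "T \<noteq> {}"
  shows "(\<Sum>F\<in>S - {{}}. (-1) ^ (card F - 1) :: int) = 1"
  using triangulation_euler_transfer(1) euler_simplex[OF triangulation_complexes(3) assms] by simp

text \<open>The star of \<open>v\<close> is transferred to the preimage of \<open>v\<close> in the
  simplex, where the faces through that point are those containing \<open>H\<close>.\<close>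

lemma triangulation_vertex_star:
  assumes v: "v \<in> vert S" and H: "H \<subseteq> T" and "\<rho> v \<in> \<phi> ` rel_interior (convex hull (r ` H))"
  shows "(\<Sum>F\<in>{F \<in> S. v \<in> F}. (-1) ^ (card F - 1) :: int) = (if H = T then (-1) ^ (card T - 1) else 0)"
proof -
  obtain x where x: "x \<in> rel_interior (convex hull (r ` H))" "\<rho> v = \<phi> x" using assms(3) by blast
  then have "x \<in> convex hull (r ` T)" using simplex_face_subset[OF H] rel_interior_subset by blast
  have "{F \<in> S. \<phi> x \<in> convex hull (\<rho> ` F)} = {F \<in> S. v \<in> F}"
    using vertex_mem_hull_iff[OF triangulation_complexes(4,5) v] x(2) by auto
  moreover have "{G \<in> Pow T. x \<in> convex hull (r ` G)} = {G \<in> Pow T. H \<subseteq> G}"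
    using rel_interior_face_mem_iff[OF triangulation_complexes(1,2) _ _ x(1)] H by auto
  moreover have "H \<noteq> {}" using x(1) by auto
  ultimately show ?thesis
    using triangulation_euler_transfer(2)[OF \<open>x \<in> convex hull (r ` T)\<close>]
      euler_simplex_star[OF triangulation_complexes(3) H] by simp
qed

lemma vertex_position:
  assumes "v \<in> vert S"
  shows "\<exists>!H. H \<subseteq> T \<and> \<rho> v \<in> \<phi> ` rel_interior (convex hull (r ` H))"
proof -
  have "\<rho> v \<in> support \<rho> S" using assms by (auto simp: support_def intro: hull_inc)
  then obtain x where x: "x \<in> convex hull (r ` T)" "\<rho> v = \<phi> x"
    using triangulation_image by blast
  have "simplicial_complex ((\<lambda>F. convex hull (r ` F)) ` Pow T)"
    using triangulation_complexes(2) by (simp add: geometric_realization_def)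
  from simplicial_complex_Union_rel_interiors[OF this] x(1)
  obtain H where H: "H \<subseteq> T" "x \<in> rel_interior (convex hull (r ` H))" by blast
  show ?thesis
  proof (intro ex1I[of _ H] conjI)
    show "\<rho> v \<in> \<phi> ` rel_interior (convex hull (r ` H))" using H x(2) by blast
    fix G assume G: "G \<subseteq> T \<and> \<rho> v \<in> \<phi> ` rel_interior (convex hull (r ` G))"
    then obtain y where y: "y \<in> rel_interior (convex hull (r ` G))" "\<phi> x = \<phi> y" using x(2) by auto
    then have "y \<in> convex hull (r ` T)" using simplex_face_subset G rel_interior_subset by blast
    then have "y = x" using triangulation_inj x(1) y(2) by (auto dest: inj_onD)
    then have "x \<in> convex hull (r ` G)" "x \<in> convex hull (r ` H)"
      using y(1) H(2) rel_interior_subset by blast+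
    then show "G = H"
      using rel_interior_face_mem_iff[OF triangulation_complexes(1,2)] y(1) H G \<open>y = x\<close> by (meson PowI subset_antisym)
  qed (rule H(1))
qed

end

section \<open>Counting faces\<close>

lemma sum_faces_by_card:
  fixes h :: "nat \<Rightarrow> int"
  assumes "finite S" "\<And>F. F \<in> S \<Longrightarrow> finite F" "\<And>F. F \<in> S \<Longrightarrow> card F \<le> 4"
  shows "(\<Sum>F\<in>S - {{}}. h (card F)) =
    int (card (abstract_faces 0 S)) * h 1 + int (card (abstract_faces 1 S)) * h 2 +
    int (card (abstract_faces 2 S)) * h 3 + int (card (abstract_faces 3 S)) * h 4"
proof -
  have "card ` (S - {{}}) \<subseteq> {1, 2, 3, 4}"
  proof
    fix k assume "k \<in> card ` (S - {{}})"
    then have "k \<noteq> 0" "k \<le> 4" using assms(2,3) by auto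
    then show "k \<in> {1, 2, 3, 4}" by auto
  qed
  then have "(\<Sum>F\<in>S - {{}}. h (card F)) = (\<Sum>k\<in>{1,2,3,4}. \<Sum>F\<in>{F \<in> S - {{}}. card F = k}. h (card F))"
    using assms(1) by (intro sum.group[symmetric]) auto
  also have "\<dots> = (\<Sum>k\<in>{1,2,3,4}. int (card (abstract_faces (k - 1) S)) * h k)"
  proof (rule sum.cong[OF refl])
    fix k :: nat assume k: "k \<in> {1,2,3,4}"
    then have "{F \<in> S - {{}}. card F = k} = abstract_faces (k - 1) S"
      by (auto simp: abstract_faces_def)
    moreover have "(\<Sum>F\<in>{F \<in> S - {{}}. card F = k}. h (card F)) = (\<Sum>F\<in>{F \<in> S - {{}}. card F = k}. h k)"
      by (intro sum.cong) auto
    ultimately show "(\<Sum>F\<in>{F \<in> S - {{}}. card F = k}. h (card F)) = int (card (abstract_faces (k - 1) S)) * h k"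
      by simp
  qed
  finally show ?thesis by simp
qed

lemma card_vert:
  assumes "abstract_complex S"
  shows "card (abstract_faces 0 S) = card (vert S)"
proof -
  have "abstract_faces 0 S = (\<lambda>v. {v}) ` vert S"
  proof (intro equalityI subsetI)
    fix F assume "F \<in> (\<lambda>v. {v}) ` vert S"
    then obtain v G where "F = {v}" "v \<in> G" "G \<in> S" by blast
    then show "F \<in> abstract_faces 0 S"
      using assms by (simp add: abstract_faces_def abstract_complex_def)
  qed (auto simp: abstract_faces_def card_1_singleton_iff)
  then show ?thesis by (simp add: card_image)
qed

text \<open>Double counting of the incidences between vertices and faces.\<close>

lemma sum_vertex_stars:
  fixes h :: "'v set \<Rightarrow> int"
  assumes "finite S" "\<And>F. F \<in> S \<Longrightarrow> finite F"
  shows "(\<Sum>v\<in>vert S. \<Sum>F\<in>{F \<in> S. v \<in> F}. h F) = (\<Sum>F\<in>S - {{}}. int (card F) * h F)"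
proof -
  have fin: "finite (vert S)" using assms by blast
  have "(\<Sum>v\<in>vert S. \<Sum>F\<in>{F \<in> S. v \<in> F}. h F) = (\<Sum>F\<in>S. \<Sum>v\<in>{v \<in> vert S. v \<in> F}. h F)"
    using fin assms(1) by (rule sum.swap_restrict)
  also have "\<dots> = (\<Sum>F\<in>S. int (card F) * h F)"
  proof (rule sum.cong[OF refl])
    fix F assume "F \<in> S"
    then have "{v \<in> vert S. v \<in> F} = F" by blast
    then show "(\<Sum>v\<in>{v \<in> vert S. v \<in> F}. h F) = int (card F) * h F" by simp
  qed
  also have "\<dots> = (\<Sum>F\<in>S - {{}}. int (card F) * h F)"
    using assms(1) by (intro sum.mono_neutral_right) auto
  finally show ?thesis .
qed

section \<open>Missing edges along the edges of the simplex\<close>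

lemma connected_meets_level:
  fixes C :: "'a::topological_space set" and l :: "'a \<Rightarrow> real"
  assumes "connected C" "continuous_on C l" "x \<in> C" "y \<in> C" "l x \<le> s" "s \<le> l y"
  obtains z where "z \<in> C" "l z = s"
proof -
  have "connected (l ` C)" using assms(1,2) by (rule connected_continuous_image[rotated])
  then have "s \<in> l ` C"
    using assms(3-6) connectedD_interval by blast
  then show thesis using that by blast
qed

text \<open>The inner product with the direction \<open>b - a\<close> serves as a real coordinate
  along the segment.\<close>

lemma inner_closed_segment_inj:
  fixes a b :: "'a::real_inner"
  assumes "x \<in> closed_segment a b" "y \<in> closed_segment a b" "(x - a) \<bullet> (b - a) = (y - a) \<bullet> (b - a)" "a \<noteq> b"
  shows "x = y"
proof -
  obtain s where s: "x = (1 - s) *\<^sub>R a + s *\<^sub>R b" using assms(1) by (auto simp: in_segment)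
  obtain t where t: "y = (1 - t) *\<^sub>R a + t *\<^sub>R b" using assms(2) by (auto simp: in_segment)
  have "x - a = s *\<^sub>R (b - a)" "y - a = t *\<^sub>R (b - a)"
    by (simp_all add: s t algebra_simps)
  then have "s * ((b - a) \<bullet> (b - a)) = t * ((b - a) \<bullet> (b - a))" using assms(3) by simp
  then have "s = t" using assms(4) by simp
  then show ?thesis using s t by simp
qed

lemma inner_closed_segment_nonneg:
  fixes a b :: "'a::real_inner"
  assumes "x \<in> closed_segment a b"
  shows "(x - a) \<bullet> (b - a) \<ge> 0"
proof -
  obtain s where s: "x = (1 - s) *\<^sub>R a + s *\<^sub>R b" "0 \<le> s" using assms by (auto simp: in_segment)
  have "x - a = s *\<^sub>R (b - a)" by (simp add: s algebra_simps)
  then show ?thesis using s(2) by simp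
qed

context
  fixes T :: "'t set" and r :: "'t \<Rightarrow> 'a::euclidean_space"
    and S :: "'v set set" and \<rho> :: "'v \<Rightarrow> 'e::euclidean_space" and \<phi> :: "'a \<Rightarrow> 'e"
  assumes triangulation: "induced_triangulation T r S \<rho> \<phi>"
begin

definition verts_on :: "'t set \<Rightarrow> 'v set" where
  "verts_on F = {v \<in> vert S. \<rho> v \<in> \<phi> ` (convex hull (r ` F))}"

lemma finite_verts_on: "finite (verts_on F)"
  using triangulation_complexes(7)[OF triangulation] unfolding verts_on_def by (rule finite_subset[rotated]) blast

text \<open>The carrier of a vertex: the smallest face of the simplex whose image contains it. The
  description is proper for vertices of \<open>S\<close> by \<open>vertex_position\<close>.\<close>

definition position :: "'v \<Rightarrow> 't set" where
  "position v = (THE H. H \<subseteq> T \<and> \<rho> v \<in> \<phi> ` rel_interior (convex hull (r ` H)))"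

lemma position:
  assumes "v \<in> vert S"
  shows "position v \<subseteq> T" "\<rho> v \<in> \<phi> ` rel_interior (convex hull (r ` position v))" "position v \<noteq> {}"
proof -
  have "position v \<subseteq> T \<and> \<rho> v \<in> \<phi> ` rel_interior (convex hull (r ` position v))"
    unfolding position_def by (rule theI'[OF vertex_position[OF triangulation assms]])
  then show "position v \<subseteq> T" "\<rho> v \<in> \<phi> ` rel_interior (convex hull (r ` position v))" "position v \<noteq> {}"
    by auto
qed

lemma position_eqI:
  assumes "v \<in> vert S" "H \<subseteq> T" "\<rho> v \<in> \<phi> ` rel_interior (convex hull (r ` H))"
  shows "position v = H"
  using vertex_position[OF triangulation assms(1)] position[OF assms(1)] assms(2,3) by blast

lemma verts_on_iff:
  assumes "v \<in> vert S" "F \<subseteq> T"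
  shows "v \<in> verts_on F \<longleftrightarrow> position v \<subseteq> F"
proof -
  note complex = triangulation_complexes[OF triangulation]
  obtain x where x: "x \<in> rel_interior (convex hull (r ` position v))" "\<rho> v = \<phi> x"
    using position(2)[OF assms(1)] by blast
  have "x \<in> convex hull (r ` T)"
    using x(1) rel_interior_subset simplex_face_subset[OF triangulation position(1)[OF assms(1)]] by blast
  then have "\<phi> x \<in> \<phi> ` (convex hull (r ` F)) \<longleftrightarrow> x \<in> convex hull (r ` F)"
    by (rule inj_on_image_mem_iff[OF triangulation_inj[OF triangulation]])
      (rule simplex_face_subset[OF triangulation assms(2)])
  then show ?thesis
    using rel_interior_face_mem_iff[OF complex(1,2) _ _ x(1), of F] assms x(2) position(1)[OF assms(1)]
    by (simp add: verts_on_def)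
qed

lemma verts_in_rel_interiors_position:
  "verts_in_rel_interiors k T r S \<rho> \<phi> = {v \<in> vert S. card (position v) = k + 1}"
proof (intro equalityI subsetI)
  fix v assume "v \<in> verts_in_rel_interiors k T r S \<rho> \<phi>"
  then obtain F where "v \<in> vert S" "F \<subseteq> T" "card F = k + 1" "\<rho> v \<in> \<phi> ` rel_interior (convex hull (r ` F))"
    unfolding verts_in_rel_interiors_def by blast
  then show "v \<in> {v \<in> vert S. card (position v) = k + 1}"
    using position_eqI[of v F] by blast
next
  fix v assume "v \<in> {v \<in> vert S. card (position v) = k + 1}"
  then show "v \<in> verts_in_rel_interiors k T r S \<rho> \<phi>"
    using position[of v] unfolding verts_in_rel_interiors_def by blast
qed

text \<open>Here inducedness does its work: a face of \<open>S\<close> with all vertices on an edge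
  of the simplex cannot bulge into the interior, as it belongs to the subcomplex supported on that
  edge.\<close>

lemma induced_face_subset:
  assumes "F \<subseteq> T" "G \<in> S" "G \<subseteq> verts_on F"
  shows "convex hull (\<rho> ` G) \<subseteq> \<phi> ` (convex hull (r ` F))"
proof -
  note complex = triangulation_complexes[OF triangulation]
  obtain S' where S': "induced_subcomplex S' S" "\<phi> ` (convex hull (r ` F)) = support \<rho> S'"
    using triangulation assms(1) unfolding induced_triangulation_def by blast
  have "v \<in> vert S'" if "v \<in> G" for v
  proof -
    have v: "v \<in> vert S" "\<rho> v \<in> support \<rho> S'"
      using assms(2,3) that S'(2) by (auto simp: verts_on_def)
    then obtain H where H: "H \<in> S'" "\<rho> v \<in> convex hull (\<rho> ` H)" by (auto simp: support_def)
    then have "H \<in> S" using S'(1) by (auto simp: induced_subcomplex_def)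
    then show ?thesis using vertex_mem_hull_iff[OF complex(4,5) v(1)] H by blast
  qed
  then have "G \<in> S'" using S'(1) assms(2) by (auto simp: induced_subcomplex_def)
  then show ?thesis using S'(2) by (auto simp: support_def)
qed

text \<open>The subcomplex belonging to the face \<open>{t}\<close> has a one-point support, so it
  has a nonempty face, and each vertex of that face sits at this point.\<close>

lemma corner_vertex:
  assumes "t \<in> T"
  obtains v where "v \<in> vert S" "\<rho> v = \<phi> (r t)"
proof -
  obtain S' where S': "induced_subcomplex S' S" "\<phi> ` (convex hull (r ` {t})) = support \<rho> S'"
    using triangulation assms unfolding induced_triangulation_def by blast
  then have sup: "support \<rho> S' = {\<phi> (r t)}" by simp
  then obtain H where H: "H \<in> S'" "H \<noteq> {}" unfolding support_def by fastforce
  then obtain v where "v \<in> H" by blast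
  then have "\<rho> v \<in> support \<rho> S'" using H(1) unfolding support_def by (blast intro: hull_inc)
  moreover have "v \<in> vert S" using S'(1) H(1) \<open>v \<in> H\<close> by (auto simp: induced_subcomplex_def)
  ultimately show thesis using that sup by blast
qed

text \<open>Two edges of \<open>S\<close> leaving the same corner of a subdivided edge would overlap.\<close>

lemma corner_neighbour_unique:
  assumes T: "t \<in> T" "u \<in> T" "t \<noteq> u" and p: "p \<in> vert S" "\<rho> p = \<phi> (r t)"
    and w: "w \<in> verts_on {t, u}" "w \<noteq> p" "{p, w} \<in> S"
    and w': "w' \<in> verts_on {t, u}" "w' \<noteq> p" "{p, w'} \<in> S"
  shows "w = w'"
proof -
  note complex = triangulation_complexes[OF triangulation]
  have seg: "convex hull (r ` {t, u}) = closed_segment (r t) (r u)"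
    by (simp add: segment_convex_hull)
  have sub: "closed_segment (r t) (r u) \<subseteq> convex hull (r ` T)"
    using simplex_face_subset[OF triangulation, of "{t, u}"] T seg by simp
  have "r t \<noteq> r u"
    using complex(2) T by (auto simp: geometric_realization_def dest: inj_onD)
  obtain g where g: "homeomorphism (convex hull (r ` T)) (support \<rho> S) \<phi> g"
    using triangulation_homeomorphism[OF triangulation] by blast
  \<comment> \<open>Up to scale, the coordinate along the edge measured from the corner
    \<open>r t\<close>, pulled back through the inverse \<open>g\<close>.\<close>
  define l where "l z = (g z - r t) \<bullet> (r u - r t)" for z
  have "w = w'"
    if w: "w \<in> verts_on {t, u}" "w \<noteq> p" "{p, w} \<in> S"
    and w': "w' \<in> verts_on {t, u}" "w' \<noteq> p" "{p, w'} \<in> S"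
    and le: "l (\<rho> w) \<le> l (\<rho> w')" for w w'
  proof -
    let ?C = "convex hull (\<rho> ` {p, w'})"
    have "p \<in> verts_on {t, u}" using p by (auto simp: verts_on_def intro!: hull_inc)
    then have "{t, u} \<subseteq> T" "{p, w'} \<subseteq> verts_on {t, u}" using T w'(1) by auto
    then have C: "?C \<subseteq> \<phi> ` closed_segment (r t) (r u)"
      using induced_face_subset[OF _ w'(3), of "{t, u}"] unfolding seg by blast
    have gC: "g z \<in> closed_segment (r t) (r u)" "\<phi> (g z) = z" if "z \<in> \<phi> ` closed_segment (r t) (r u)" for z
      using that homeomorphism_apply1[OF g] sub by auto
    have "continuous_on ?C l"
    proof -
      have "?C \<subseteq> support \<rho> S" using w'(3) by (auto simp: support_def)
      then have "continuous_on ?C g" using g homeomorphism_cont2 continuous_on_subset by blast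
      then show ?thesis unfolding l_def by (intro continuous_intros)
    qed
    moreover have w_seg: "\<rho> w \<in> \<phi> ` closed_segment (r t) (r u)"
      using w(1) unfolding verts_on_def seg by blast
    moreover have "g (\<phi> (r t)) = r t"
      using homeomorphism_apply1[OF g] sub by auto
    then have "l (\<rho> p) = 0" by (simp add: l_def p(2))
    moreover have "l (\<rho> w) \<ge> 0"
      unfolding l_def using gC(1)[OF w_seg] by (rule inner_closed_segment_nonneg)
    \<comment> \<open>The edge from \<open>p\<close> to \<open>w'\<close> runs from level 0 to a
      level at least that of \<open>w\<close>, so it takes the level of \<open>w\<close>; as it
      stays on the segment it passes through \<open>w\<close> itself. A simplex contains no vertices
      but its own, so \<open>w = w'\<close>.\<close>
    ultimately obtain z where z: "z \<in> ?C" "l z = l (\<rho> w)"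
      using le connected_meets_level[of ?C l "\<rho> p" "\<rho> w'" "l (\<rho> w)"]
      by (auto simp: convex_connected intro: hull_inc)
    then have "z \<in> \<phi> ` closed_segment (r t) (r u)" using C by blast
    then have "g z = g (\<rho> w)"
      using inner_closed_segment_inj[OF gC(1) gC(1)] w_seg z(2) \<open>r t \<noteq> r u\<close> unfolding l_def by blast
    then have "z = \<rho> w"
      using gC(2) w_seg \<open>z \<in> \<phi> ` closed_segment (r t) (r u)\<close> by metis
    then have "w \<in> {p, w'}"
      using vertex_mem_hull_iff[OF complex(4,5) _ w'(3), of w] z(1) w(1) by (simp add: verts_on_def)
    then show ?thesis using w(2) by blast
  qed
  then show ?thesis using w w' by (metis linear)
qed

lemma corner_position:
  assumes "v \<in> vert S" "\<rho> v = \<phi> (r t)" "t \<in> T"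
  shows "position v = {t}"
  using assms by (intro position_eqI) auto

text \<open>Join one corner \<open>p\<close> to all other vertices on the edge. At most one of these
  is a neighbour of \<open>p\<close>, so the remaining pairs are missing from
  \<open>S\<close>.\<close>

lemma missing_edges_on_edge:
  assumes F: "F \<subseteq> T" "card F = 2"
  shows "\<exists>M. finite M \<and> (\<forall>e\<in>M. e \<subseteq> verts_on F \<and> card e = 2 \<and> e \<notin> S) \<and>
    card {v \<in> vert S. position v = F} \<le> card M"
proof -
  obtain t u where tu: "F = {t, u}" "t \<noteq> u" using F(2) by (auto simp: card_2_iff)
  then have T: "t \<in> T" "u \<in> T" using F(1) by auto
  obtain p where p: "p \<in> vert S" "\<rho> p = \<phi> (r t)" using corner_vertex[OF T(1)] .
  obtain q where q: "q \<in> vert S" "\<rho> q = \<phi> (r u)" using corner_vertex[OF T(2)] .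
  have pos: "position p = {t}" "position q = {u}"
    using corner_position p q T by auto
  then have pq: "p \<noteq> q" "p \<in> verts_on F" "q \<in> verts_on F"
    using tu p q F(1) by (auto simp: verts_on_iff)
  let ?V = "verts_on F - {p}"
  let ?N = "{w \<in> ?V. {p, w} \<in> S}" and ?M = "{w \<in> ?V. {p, w} \<notin> S}"
  have fin: "finite ?V" using finite_verts_on by simp
  have "w = w'" if "w \<in> ?N" "w' \<in> ?N" for w w'
    using corner_neighbour_unique[OF T tu(2) p] that tu(1) by auto
  then have "card ?N \<le> 1"
    unfolding One_nat_def using fin by (intro card_le_Suc0_iff_eq[THEN iffD2]) auto
  have "?N \<union> ?M = ?V" "?N \<inter> ?M = {}" by auto
  then have "card ?V = card ?N + card ?M"
    using card_Un_disjoint[of ?N ?M] fin by simp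
  \<comment> \<open>The opposite corner \<open>q\<close> makes up for the one possible neighbour, so
    no inner vertex of the edge is lost in the count.\<close>
  moreover have "card ?V = Suc (card (?V - {q}))"
    using fin pq by (intro card.remove) auto
  moreover have "card {v \<in> vert S. position v = F} \<le> card (?V - {q})"
  proof (intro card_mono subsetI)
    fix v assume v: "v \<in> {v \<in> vert S. position v = F}"
    then have "v \<noteq> p" "v \<noteq> q" using pos tu by auto
    then show "v \<in> ?V - {q}" using v F(1) by (simp add: verts_on_iff)
  qed (use fin in simp)
  ultimately have "card {v \<in> vert S. position v = F} \<le> card ?M"
    using \<open>card ?N \<le> 1\<close> by linarith
  moreover have "card ((\<lambda>w. {p, w}) ` ?M) = card ?M"
    by (intro card_image inj_onI) (auto simp: doubleton_eq_iff)
  ultimately show ?thesis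
    using fin pq(2) by (intro exI[of _ "(\<lambda>w. {p, w}) ` ?M"]) (auto simp: card_2_iff)
qed

text \<open>The missing pairs found on different edges of the simplex are different: such edges
  share at most one corner, and only one vertex of \<open>S\<close> can sit there.\<close>

lemma card_edges_le:
  "card (abstract_faces 1 S) + card (verts_in_rel_interiors 1 T r S \<rho> \<phi>) \<le> card (vert S) choose 2"
proof -
  note complex = triangulation_complexes[OF triangulation]
  define E where "E = {F. F \<subseteq> T \<and> card F = 2}"
  have "finite E" using complex(3) by (simp add: E_def)
  have "\<forall>F\<in>E. \<exists>M. finite M \<and> (\<forall>e\<in>M. e \<subseteq> verts_on F \<and> card e = 2 \<and> e \<notin> S) \<and>
    card {v \<in> vert S. position v = F} \<le> card M"
    using missing_edges_on_edge by (simp add: E_def)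
  from bchoice[OF this] obtain M where M: "\<forall>F\<in>E. finite (M F) \<and>
      (\<forall>e\<in>M F. e \<subseteq> verts_on F \<and> card e = 2 \<and> e \<notin> S) \<and> card {v \<in> vert S. position v = F} \<le> card (M F)" ..
  then have M_fin: "F \<in> E \<Longrightarrow> finite (M F)"
    and M_edge: "\<lbrakk>F \<in> E; e \<in> M F\<rbrakk> \<Longrightarrow> e \<subseteq> verts_on F \<and> card e = 2 \<and> e \<notin> S"
    and M_card: "F \<in> E \<Longrightarrow> card {v \<in> vert S. position v = F} \<le> card (M F)" for F e
    by auto
  have disj: "M F \<inter> M G = {}" if FG: "F \<in> E" "G \<in> E" "F \<noteq> G" for F G
  proof (rule ccontr)
    assume "M F \<inter> M G \<noteq> {}"
    then obtain e where "e \<in> M F" "e \<in> M G" by blast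
    then have e: "e \<subseteq> verts_on F" "e \<subseteq> verts_on G" "card e = 2" using M_edge FG(1,2) by blast+
    then obtain v w where vw: "e = {v, w}" "v \<noteq> w" by (auto simp: card_2_iff)
    have "finite F" "finite G" using FG complex(3) by (auto simp: E_def intro: finite_subset)
    \<comment> \<open>Distinct two-element sets meet in at most one point; the carriers of both ends
      of the pair \<open>e\<close> are nonempty subsets of that intersection, so the ends
      coincide.\<close>
    have "card (F \<inter> G) \<noteq> 2"
      using card_subset_eq[of F "F \<inter> G"] card_subset_eq[of G "F \<inter> G"] FG \<open>finite F\<close> \<open>finite G\<close>
      by (auto simp: E_def)
    moreover have "card (F \<inter> G) \<le> 2"
      using card_mono[of F "F \<inter> G"] FG \<open>finite F\<close> by (simp add: E_def)
    ultimately have "card (F \<inter> G) \<le> Suc 0" by linarith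
    then have single: "\<forall>x\<in>F \<inter> G. \<forall>y\<in>F \<inter> G. x = y"
      using \<open>finite F\<close> by (simp add: card_le_Suc0_iff_eq)
    have vS: "v \<in> vert S" "w \<in> vert S" using e vw by (auto simp: verts_on_def)
    then have sub: "position v \<subseteq> F \<inter> G" "position w \<subseteq> F \<inter> G"
      using e(1,2) vw FG verts_on_iff by (auto simp: E_def)
    obtain t where t: "t \<in> position v" using position(3)[OF vS(1)] by blast
    have "x = t" if "x \<in> F \<inter> G" for x
      using single that t sub(1) by (meson subsetD)
    then have "F \<inter> G \<subseteq> {t}" by (simp add: subset_iff)
    then have "position v \<subseteq> {t}" "position w \<subseteq> {t}" using sub by (meson subset_trans)+
    then have "position v = {t}" "position w = {t}"
      using position(3)[OF vS(1)] position(3)[OF vS(2)] by (meson subset_singletonD)+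
    then have "\<rho> v = \<rho> w" using position(2)[OF vS(1)] position(2)[OF vS(2)] by auto
    then show False using vw(2) vS complex(5) by (auto simp: geometric_realization_def dest: inj_onD)
  qed
  have "verts_in_rel_interiors 1 T r S \<rho> \<phi> = (\<Union>F\<in>E. {v \<in> vert S. position v = F})"
    using position(1) by (auto simp: verts_in_rel_interiors_position E_def numeral_2_eq_2 simp del: Union_iff)
  then have "card (verts_in_rel_interiors 1 T r S \<rho> \<phi>) \<le> (\<Sum>F\<in>E. card {v \<in> vert S. position v = F})"
    using card_UN_le[OF \<open>finite E\<close>] by simp
  also have "\<dots> \<le> (\<Sum>F\<in>E. card (M F))" by (intro sum_mono M_card)
  also have "\<dots> = card (\<Union>F\<in>E. M F)"
    using M_fin disj \<open>finite E\<close> by (intro card_UN_disjoint[symmetric]) simp_all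
  finally have "card (abstract_faces 1 S) + card (verts_in_rel_interiors 1 T r S \<rho> \<phi>) \<le>
      card (abstract_faces 1 S) + card (\<Union>F\<in>E. M F)" by simp
  also have "\<dots> = card (abstract_faces 1 S \<union> (\<Union>F\<in>E. M F))"
  proof (rule card_Un_disjoint[symmetric])
    show "abstract_faces 1 S \<inter> (\<Union>F\<in>E. M F) = {}" using M_edge unfolding abstract_faces_def by blast
  qed (use M_fin complex(6) \<open>finite E\<close> in \<open>simp_all add: abstract_faces_def\<close>)
  also have "\<dots> \<le> card {e. e \<subseteq> vert S \<and> card e = 2}"
  proof (rule card_mono)
    show "finite {e. e \<subseteq> vert S \<and> card e = 2}" using complex(7) by simp
    show "abstract_faces 1 S \<union> (\<Union>F\<in>E. M F) \<subseteq> {e. e \<subseteq> vert S \<and> card e = 2}"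
    proof (intro Un_least UN_least subsetI)
      fix F e assume "F \<in> E" "e \<in> M F"
      then have "e \<subseteq> verts_on F" "card e = 2" using M_edge by blast+
      then show "e \<in> {e. e \<subseteq> vert S \<and> card e = 2}" unfolding verts_on_def by blast
    qed (auto simp: abstract_faces_def)
  qed
  also have "\<dots> = card (vert S) choose 2"
    using complex(7) by (rule n_subsets)
  finally show ?thesis .
qed

section \<open>From the edge count to the facet count\<close>

lemma card_vert_eq_sum:
  assumes "card T = 4"
  shows "card (vert S) = (\<Sum>k<4. card (verts_in_rel_interiors k T r S \<rho> \<phi>))"
proof -
  note complex = triangulation_complexes[OF triangulation]
  have "vert S = (\<Union>k<4. verts_in_rel_interiors k T r S \<rho> \<phi>)"
  proof (intro equalityI subsetI)
    fix v assume v: "v \<in> vert S"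
    then have "card (position v) \<le> 4" using position(1) complex(3) assms card_mono by metis
    moreover have "card (position v) \<noteq> 0"
      using position(1,3)[OF v] complex(3) finite_subset by fastforce
    ultimately show "v \<in> (\<Union>k<4. verts_in_rel_interiors k T r S \<rho> \<phi>)"
      using v by (auto simp: verts_in_rel_interiors_position intro!: bexI[of _ "card (position v) - 1"])
  qed (auto simp: verts_in_rel_interiors_def)
  also have "card \<dots> = (\<Sum>k<4. card (verts_in_rel_interiors k T r S \<rho> \<phi>))"
    using complex(7) by (intro card_UN_disjoint) (auto simp: verts_in_rel_interiors_position simp del: Union_iff)
  finally show ?thesis .
qed

lemma card_facets_eq:
  assumes "card T = 4"
  shows "int (card (abstract_faces 3 S)) = int (card (abstract_faces 1 S)) - 2 * int (card (vert S)) + 3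
    + int (card (verts_in_rel_interiors 3 T r S \<rho> \<phi>))"
proof -
  note complex = triangulation_complexes[OF triangulation]
  have fin: "finite F" if "F \<in> S" for F using complex(4) that by (simp add: abstract_complex_def)
  have dim: "card F \<le> 4" if "F \<in> S" for F using card_face_le[OF triangulation that] assms by simp
  note count = sum_faces_by_card[OF complex(6) fin dim]
  let ?b4 = "int (card (verts_in_rel_interiors 3 T r S \<rho> \<phi>))"
  have "T \<noteq> {}" using assms by auto
  then have euler: "int (card (abstract_faces 0 S)) - int (card (abstract_faces 1 S))
      + int (card (abstract_faces 2 S)) - int (card (abstract_faces 3 S)) = 1"
    using triangulation_euler[OF triangulation] count[of "\<lambda>k. (-1) ^ (k - 1)"] by simp
  \<comment> \<open>Only vertices with carrier \<open>T\<close> have a nonzero star sum, namely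
    \<open>(-1) ^ (4 - 1)\<close>.\<close>
  have pos_T: "position v = T \<longleftrightarrow> card (position v) = 4" if "v \<in> vert S" for v
    using position(1)[OF that] complex(3) assms card_subset_eq by metis
  have "(\<Sum>v\<in>vert S. \<Sum>F\<in>{F \<in> S. v \<in> F}. (-1) ^ (card F - 1) :: int) =
      (\<Sum>v\<in>vert S. if card (position v) = 4 then - 1 else 0)"
  proof (rule sum.cong[OF refl])
    fix v assume v: "v \<in> vert S"
    show "(\<Sum>F\<in>{F \<in> S. v \<in> F}. (-1) ^ (card F - 1) :: int) = (if card (position v) = 4 then - 1 else 0)"
      using triangulation_vertex_star[OF triangulation v position(1,2)[OF v]] pos_T[OF v] assms by simp
  qed
  also have "\<dots> = - ?b4"
    using complex(7) by (simp add: verts_in_rel_interiors_position sum.If_cases Int_def conj_commute)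
  finally have "int (card (abstract_faces 0 S)) - 2 * int (card (abstract_faces 1 S))
      + 3 * int (card (abstract_faces 2 S)) - 4 * int (card (abstract_faces 3 S)) = - ?b4"
    using sum_vertex_stars[of S "\<lambda>F. (-1) ^ (card F - 1)"] complex(6) fin count[of "\<lambda>k. int k * (-1) ^ (k - 1)"] by simp
  then show ?thesis
    using euler card_vert[OF complex(4)] by linarith
qed

end

text \<open>Insert \<open>b (b - 1) / 2 - b2\<close> for the number of edges and
  \<open>b - 4 - b2 - b3\<close> for \<open>b4\<close> in \<open>card_facets_eq\<close>. Everything
  is doubled to avoid division.\<close>

lemma card_facets_le:
  assumes tri: "induced_triangulation T r S \<rho> \<phi>" and T: "card T = 4"
    and b: "card (verts_in_rel_interiors 0 T r S \<rho> \<phi>) = 4"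
      "card (verts_in_rel_interiors 1 T r S \<rho> \<phi>) = b2"
      "card (verts_in_rel_interiors 2 T r S \<rho> \<phi>) = b3"
      "card (verts_in_rel_interiors 3 T r S \<rho> \<phi>) = b4"
    and sum: "b = 4 + b2 + b3 + b4"
  shows "2 * int (card (abstract_faces 3 S)) \<le> int b * (int b - 3) - 4 * int b2 - 2 * int b3 - 2"
proof -
  have vert: "card (vert S) = b"
    using card_vert_eq_sum[OF tri T] b sum by (simp add: eval_nat_numeral)
  have "2 * (card (abstract_faces 1 S) + b2) \<le> 2 * (b choose 2)"
    using card_edges_le[OF tri] vert b(2) by simp
  also have "\<dots> = b * (b - 1)"
    unfolding choose_two by (rule dvd_mult_div_cancel) (cases b; simp)
  finally have "int (2 * (card (abstract_faces 1 S) + b2)) \<le> int (b * (b - 1))"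
    by (rule of_nat_mono)
  then have "2 * (int (card (abstract_faces 1 S)) + int b2) \<le> int b * (int b - 1)"
    using sum by (simp add: of_nat_diff)
  then show ?thesis
    using card_facets_eq[OF tri T] vert b(4) sum by (simp add: algebra_simps)
qed

section \<open>Facets of the cyclic polytope\<close>

lemma moment_curve4_nth [simp]:
  "moment_curve4 t $ 1 = t" "moment_curve4 t $ 2 = t ^ 2" "moment_curve4 t $ 3 = t ^ 3" "moment_curve4 t $ 4 = t ^ 4"
  by (simp_all add: moment_curve4_def vector_def)

lemma inj_moment_curve4: "inj moment_curve4"
  by (metis injI moment_curve4_nth(1))

text \<open>Combine the equations with the coefficients of the cubic with roots \<open>b\<close>,
  \<open>c\<close>, \<open>d\<close>: the other three weights cancel and \<open>wa\<close> keeps the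
  value of the cubic at \<open>a\<close>, which is nonzero.\<close>

lemma vandermonde4_kernel:
  fixes a b c d :: real
  assumes "wa + wb + wc + wd = 0" "wa * a + wb * b + wc * c + wd * d = 0"
    "wa * a ^ 2 + wb * b ^ 2 + wc * c ^ 2 + wd * d ^ 2 = 0"
    "wa * a ^ 3 + wb * b ^ 3 + wc * c ^ 3 + wd * d ^ 3 = 0"
    and "a \<noteq> b" "a \<noteq> c" "a \<noteq> d"
  shows "wa = 0"
proof -
  have "wa * ((a - b) * (a - c) * (a - d)) =
      (wa * a ^ 3 + wb * b ^ 3 + wc * c ^ 3 + wd * d ^ 3)
      - (b + c + d) * (wa * a ^ 2 + wb * b ^ 2 + wc * c ^ 2 + wd * d ^ 2)
      + (b * c + b * d + c * d) * (wa * a + wb * b + wc * c + wd * d)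
      - b * c * d * (wa + wb + wc + wd)"
    by algebra
  then have "wa * ((a - b) * (a - c) * (a - d)) = 0" unfolding assms(1-4) by simp
  then show ?thesis using assms(5-7) by simp
qed

lemma moment_curve4_affine_independent:
  assumes "distinct [a, b, c, d]"
  shows "\<not> affine_dependent (moment_curve4 ` {a, b, c, d})"
proof
  let ?m = moment_curve4
  assume "affine_dependent (?m ` {a, b, c, d})"
  then obtain U where U: "sum U (?m ` {a, b, c, d}) = 0" "\<exists>v\<in>?m ` {a, b, c, d}. U v \<noteq> 0"
      "(\<Sum>v\<in>?m ` {a, b, c, d}. U v *\<^sub>R v) = 0"
    using affine_dependent_explicit_finite[of "?m ` {a, b, c, d}"] by auto
  define w where "w x = U (?m x)" for x
  have ne: "a \<noteq> b" "a \<noteq> c" "a \<noteq> d" "b \<noteq> c" "b \<noteq> d" "c \<noteq> d" using assms by auto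
  have s: "w a + w b + w c + w d = 0"
    using U(1) ne by (simp add: inj_eq[OF inj_moment_curve4] w_def add.assoc)
  have "w a *\<^sub>R ?m a + w b *\<^sub>R ?m b + w c *\<^sub>R ?m c + w d *\<^sub>R ?m d = 0"
    using U(3) ne by (simp add: inj_eq[OF inj_moment_curve4] w_def add.assoc)
  from arg_cong[OF this, of "\<lambda>x. x $ 1"] arg_cong[OF this, of "\<lambda>x. x $ 2"] arg_cong[OF this, of "\<lambda>x. x $ 3"]
  have e: "w a * a + w b * b + w c * c + w d * d = 0"
    "w a * a ^ 2 + w b * b ^ 2 + w c * c ^ 2 + w d * d ^ 2 = 0"
    "w a * a ^ 3 + w b * b ^ 3 + w c * c ^ 3 + w d * d ^ 3 = 0"
    by simp_all
  have "w a = 0" using vandermonde4_kernel[OF s e] ne by simp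
  moreover have "w b = 0"
    using vandermonde4_kernel[of "w b" "w a" "w c" "w d" b a c d] s e ne by (simp add: ac_simps)
  moreover have "w c = 0"
    using vandermonde4_kernel[of "w c" "w a" "w b" "w d" c a b d] s e ne by (simp add: ac_simps)
  moreover have "w d = 0"
    using vandermonde4_kernel[of "w d" "w a" "w b" "w c" d a b c] s e ne by (simp add: ac_simps)
  ultimately show False using U(2) by (auto simp: w_def)
qed

text \<open>A quartic in \<open>t\<close> is an affine functional on the moment curve. The quartic
  with the four given roots and a constant sign on \<open>{1..n}\<close> therefore cuts out a
  supporting hyperplane through exactly four vertices; their affine independence makes the face
  three-dimensional.\<close>

lemma cyclic_polytope4_facet:
  fixes p q u v n :: nat and \<sigma> :: real
  assumes G: "{p, q, u, v} \<subseteq> {1..n}" "distinct [p, q, u, v]" and "\<sigma> \<noteq> 0"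
    and sign: "\<And>k. k \<in> {1..n} \<Longrightarrow>
      \<sigma> * ((real k - real p) * (real k - real q) * (real k - real u) * (real k - real v)) \<ge> 0"
  shows "\<exists>F. F face_of cyclic_polytope4 n \<and> aff_dim F = 3 \<and>
    {k \<in> {1..n}. moment_curve4 (real k) \<in> F} = {p, q, u, v}"
proof -
  define P Q U V where "P = real p" "Q = real q" "U = real u" "V = real v"
  \<comment> \<open>The signed elementary symmetric functions of the roots, i.e. the coefficients of
    the quartic times \<open>\<sigma>\<close>; \<open>c\<close> below is the negated constant
    term.\<close>
  define a :: "real ^ 4" where "a = vector
    [- \<sigma> * (P*Q*U + P*Q*V + P*U*V + Q*U*V), \<sigma> * (P*Q + P*U + P*V + Q*U + Q*V + U*V), - \<sigma> * (P + Q + U + V), \<sigma>]"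
  define c where "c = - \<sigma> * (P * Q * U * V)"
  define F where "F = cyclic_polytope4 n \<inter> {x. a \<bullet> x = c}"
  let ?m = "\<lambda>k. moment_curve4 (real k)"
  have a_nth: "a $ 1 = - \<sigma> * (P*Q*U + P*Q*V + P*U*V + Q*U*V)" "a $ 2 = \<sigma> * (P*Q + P*U + P*V + Q*U + Q*V + U*V)"
      "a $ 3 = - \<sigma> * (P + Q + U + V)" "a $ 4 = \<sigma>"
    by (simp_all add: a_def vector_def)
  have eval: "a \<bullet> moment_curve4 t - c = \<sigma> * ((t - P) * (t - Q) * (t - U) * (t - V))" for t
    unfolding inner_vec_def sum_4 a_nth moment_curve4_nth c_def inner_real_def by algebra
  have "cyclic_polytope4 n \<subseteq> {x. a \<bullet> x \<ge> c}"
    unfolding cyclic_polytope4_def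
  proof (rule hull_minimal)
    show "?m ` {1..n} \<subseteq> {x. a \<bullet> x \<ge> c}"
    proof clarsimp
      fix k :: nat assume "Suc 0 \<le> k" "k \<le> n"
      then show "c \<le> a \<bullet> ?m k"
        using sign[of k] eval[of "real k"] by (simp add: P_Q_U_V_def)
    qed
  qed (rule convex_halfspace_ge)
  then have face: "F face_of cyclic_polytope4 n"
    unfolding F_def cyclic_polytope4_def
    by (intro face_of_Int_supporting_hyperplane_ge) (auto simp: convex_convex_hull)
  have mem: "?m k \<in> F \<longleftrightarrow> k \<in> {p, q, u, v}" if "k \<in> {1..n}" for k
  proof -
    have "?m k \<in> cyclic_polytope4 n"
      using that by (auto simp: cyclic_polytope4_def intro!: hull_inc)
    then have "?m k \<in> F \<longleftrightarrow> a \<bullet> ?m k - c = 0" by (simp add: F_def)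
    also have "\<dots> \<longleftrightarrow> k \<in> {p, q, u, v}"
      unfolding eval using \<open>\<sigma> \<noteq> 0\<close> by (simp add: P_Q_U_V_def)
    finally show ?thesis .
  qed
  then have verts: "{k \<in> {1..n}. ?m k \<in> F} = {p, q, u, v}" using G(1) by blast
  have "aff_dim F \<le> 3"
  proof -
    have "a \<noteq> 0" using a_nth(4) \<open>\<sigma> \<noteq> 0\<close> by auto
    then have "aff_dim {x. a \<bullet> x = c} = 3" by (simp add: aff_dim_hyperplane)
    then show ?thesis using aff_dim_subset[of F "{x. a \<bullet> x = c}"] by (simp add: F_def)
  qed
  moreover have "3 \<le> aff_dim F"
  proof -
    let ?M = "moment_curve4 ` {P, Q, U, V}"
    have d: "distinct [P, Q, U, V]" using G(2) by (simp add: P_Q_U_V_def)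
    have "card ?M = 4"
      using d by (simp add: inj_eq[OF inj_moment_curve4])
    then have "aff_dim ?M = 3"
      using aff_dim_affine_independent[OF moment_curve4_affine_independent[OF d]] by simp
    moreover have "?M \<subseteq> F" using mem G(1) by (auto simp: P_Q_U_V_def)
    ultimately show ?thesis using aff_dim_subset by metis
  qed
  ultimately show ?thesis using face verts by (intro exI[of _ F]) auto
qed

text \<open>No integer lies strictly between \<open>i\<close> and \<open>i + 1\<close>.\<close>

lemma consecutive_product_nonneg: "(real k - real i) * (real k - real (Suc i)) \<ge> 0"
  by (cases "k \<le> i") (auto intro: mult_nonpos_nonpos mult_nonneg_nonneg)

text \<open>The index 0 stands for the pair \<open>{n, n + 1} = {n, 1}\<close> taken cyclically, so that Gale's evenness condition
  describes the facets by two disjoint cyclically adjacent pairs.\<close>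

definition gale_set :: "nat \<Rightarrow> nat \<times> nat \<Rightarrow> nat set" where
  "gale_set n = (\<lambda>(j, i). (if i = 0 then {1, n} else {i, Suc i}) \<union> {j, Suc j})"

text \<open>The bound \<open>i < j - 1\<close> keeps the two adjacent pairs disjoint. The removed
  element would combine \<open>{n, 1}\<close> with \<open>{n - 1, n}\<close>, which share
  \<open>n\<close>.\<close>

definition gale_pairs :: "nat \<Rightarrow> (nat \<times> nat) set" where
  "gale_pairs n = (SIGMA j:{..<n}. {..<j - 1}) - {(n - 1, 0)}"

text \<open>The triangular number \<open>(n - 1) (n - 2) / 2\<close> minus the one removed pair is
  \<open>n (n - 3) / 2\<close>.\<close>

lemma card_gale_pairs:
  assumes "n \<ge> 3"
  shows "2 * int (card (gale_pairs n)) = int n * (int n - 3)"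
proof -
  have sum: "2 * (\<Sum>j<n. int (j - 1)) = (int n - 1) * (int n - 2)" if "n \<ge> 1" for n
    using that
  proof (induction n rule: dec_induct)
    case (step n)
    then show ?case by (simp add: algebra_simps of_nat_diff)
  qed simp
  have "(n - 1, 0) \<in> (SIGMA j:{..<n}. {..<j - 1})" using assms by auto
  then have "int (card (gale_pairs n)) = int (card (SIGMA j:{..<n}. {..<j - 1})) - 1"
    unfolding gale_pairs_def by (subst card.remove[of "SIGMA j:{..<n}. {..<j - 1}" "(n - 1, 0)"]) auto
  also have "card (SIGMA j:{..<n}. {..<j - 1}) = (\<Sum>j<n. j - 1)" by (simp add: card_SigmaI)
  finally show ?thesis using sum[of n] assms by (simp add: algebra_simps)
qed

text \<open>For \<open>n = 4\<close> the two index pairs both give \<open>{1, 2, 3, 4}\<close>, so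
  injectivity starts at 5.\<close>

lemma inj_on_gale_set:
  assumes "n \<ge> 5"
  shows "inj_on (gale_set n) (gale_pairs n)"
proof (rule inj_onI, clarify)
  fix j i l k
  assume x: "(j, i) \<in> gale_pairs n" and y: "(l, k) \<in> gale_pairs n"
    and eq: "gale_set n (j, i) = gale_set n (l, k)"
  have pairs: "i + 2 \<le> j" "j < n" "i = 0 \<Longrightarrow> j + 1 < n" "k + 2 \<le> l" "l < n" "k = 0 \<Longrightarrow> l + 1 < n"
    using x y by (auto simp: gale_pairs_def)
  \<comment> \<open>A set containing 1 and \<open>n\<close> can be two ordinary pairs only as
    \<open>{1, 2}\<close> and \<open>{n - 1, n}\<close>. Then 2 forces \<open>j = 2\<close>, and
    \<open>n - 1\<close> must be at most 3.\<close>
  have mixed: False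
    if "i = 0" "k \<noteq> 0" "i + 2 \<le> j" "j + 1 < n" "k + 2 \<le> l" "l < n" "gale_set n (j, i) = gale_set n (l, k)" for i j k l
  proof -
    have eq: "{1, n, j, Suc j} = {k, Suc k, l, Suc l}" using that(1,2,7) by (simp add: gale_set_def insert_commute)
    have "1 \<in> {k, Suc k, l, Suc l}" "n \<in> {k, Suc k, l, Suc l}" unfolding eq[symmetric] by simp_all
    then have "k = 1" "l = n - 1" using that by auto
    moreover have "Suc k \<in> {1, n, j, Suc j}" "l \<in> {1, n, j, Suc j}" unfolding eq by simp_all
    ultimately show False using that assms by auto
  qed
  show "j = l \<and> i = k"
  proof (cases "i = 0"; cases "k = 0")
    assume ik: "i = 0" "k = 0"
    then have eq': "{1, n, j, Suc j} = {1, n, l, Suc l}" using eq by (simp add: gale_set_def insert_commute)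
    have "j \<in> {1, n, l, Suc l}" unfolding eq'[symmetric] by simp
    moreover have "l \<in> {1, n, j, Suc j}" unfolding eq' by simp
    ultimately show ?thesis using ik pairs by auto
  next
    \<comment> \<open>The smallest element determines the first pair and the largest one the
      second.\<close>
    assume ik: "i \<noteq> 0" "k \<noteq> 0"
    then have eq': "{i, Suc i, j, Suc j} = {k, Suc k, l, Suc l}" using eq by (simp add: gale_set_def insert_commute)
    have "i \<in> {k, Suc k, l, Suc l}" "Suc j \<in> {k, Suc k, l, Suc l}" unfolding eq'[symmetric] by simp_all
    moreover have "k \<in> {i, Suc i, j, Suc j}" "Suc l \<in> {i, Suc i, j, Suc j}" unfolding eq' by simp_all
    ultimately show ?thesis using pairs by auto
  next
    assume "i = 0" "k \<noteq> 0"
    then show ?thesis using mixed[of i k j l] eq pairs by simp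
  next
    assume "i \<noteq> 0" "k = 0"
    then show ?thesis using mixed[of k i l j] eq pairs by simp
  qed
qed

lemma gale_set_facet:
  assumes "x \<in> gale_pairs n"
  shows "\<exists>F. F face_of cyclic_polytope4 n \<and> aff_dim F = 3 \<and>
    {k \<in> {1..n}. moment_curve4 (real k) \<in> F} = gale_set n x"
proof -
  obtain j i where x: "x = (j, i)" by (cases x)
  have pairs: "i + 2 \<le> j" "j < n" "i = 0 \<Longrightarrow> j + 1 < n"
    using assms by (auto simp: gale_pairs_def x)
  show ?thesis
  proof (cases "i = 0")
    case True
    have "- 1 * ((real k - real 1) * (real k - real n) * (real k - real j) * (real k - real (Suc j))) \<ge> 0"
      if "k \<in> {1..n}" for k
    proof -
      \<comment> \<open>The roots 1 and \<open>n\<close> enclose all parameters, so their factor is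
        nonpositive; hence the choice of \<open>- 1\<close> for \<open>\<sigma>\<close>.\<close>
      have "(real k - real 1) * (real n - real k) \<ge> 0" using that by (intro mult_nonneg_nonneg) auto
      from mult_nonneg_nonneg[OF this consecutive_product_nonneg[of k j]]
      show ?thesis by (simp add: algebra_simps)
    qed
    then have "\<exists>F. F face_of cyclic_polytope4 n \<and> aff_dim F = 3 \<and>
        {k \<in> {1..n}. moment_curve4 (real k) \<in> F} = {1, n, j, Suc j}"
      using pairs True by (intro cyclic_polytope4_facet[where \<sigma> = "- 1"]) auto
    moreover have "gale_set n x = {1, n, j, Suc j}" using True by (auto simp: x gale_set_def)
    ultimately show ?thesis by simp
  next
    case False
    have "1 * ((real k - real i) * (real k - real (Suc i)) * (real k - real j) * (real k - real (Suc j))) \<ge> 0" for k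
      using mult_nonneg_nonneg[OF consecutive_product_nonneg[of k i] consecutive_product_nonneg[of k j]]
      by (simp only: mult_1 mult.assoc)
    then have "\<exists>F. F face_of cyclic_polytope4 n \<and> aff_dim F = 3 \<and>
        {k \<in> {1..n}. moment_curve4 (real k) \<in> F} = {i, Suc i, j, Suc j}"
      using pairs False by (intro cyclic_polytope4_facet[where \<sigma> = 1]) auto
    moreover have "gale_set n x = {i, Suc i, j, Suc j}" using False by (auto simp: x gale_set_def)
    ultimately show ?thesis by simp
  qed
qed

text \<open>The indices of the curve points on a facet recover its Gale set, so distinct Gale sets
  come from distinct facets.\<close>

lemma num_facets_cyclic_polytope4_ge:
  assumes "n \<ge> 5"
  shows "int n * (int n - 3) \<le> 2 * int (num_faces 3 (cyclic_polytope4 n))"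
proof -
  let ?\<F> = "{F. F face_of cyclic_polytope4 n \<and> aff_dim F = 3}"
  have "polytope (cyclic_polytope4 n)"
    by (simp add: cyclic_polytope4_def polytope_convex_hull)
  then have fin: "finite ?\<F>" using finite_polytope_faces by (auto intro: finite_subset[rotated])
  have "gale_set n ` gale_pairs n \<subseteq> (\<lambda>F. {k \<in> {1..n}. moment_curve4 (real k) \<in> F}) ` ?\<F>"
  proof clarify
    fix j i assume "(j, i) \<in> gale_pairs n"
    then obtain F where "F \<in> ?\<F>" "gale_set n (j, i) = {k \<in> {1..n}. moment_curve4 (real k) \<in> F}"
      using gale_set_facet by blast
    then show "gale_set n (j, i) \<in> (\<lambda>F. {k \<in> {1..n}. moment_curve4 (real k) \<in> F}) ` ?\<F>" by (rule rev_image_eqI)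
  qed
  then have "card (gale_set n ` gale_pairs n) \<le> card ?\<F>"
    by (rule surj_card_le[OF fin])
  then have "int (card (gale_pairs n)) \<le> int (num_faces 3 (cyclic_polytope4 n))"
    unfolding card_image[OF inj_on_gale_set[OF assms]] num_faces_def by (rule of_nat_mono)
  moreover have "2 * int (card (gale_pairs n)) = int n * (int n - 3)"
    using assms by (intro card_gale_pairs) simp
  ultimately show ?thesis by linarith
qed

section \<open>Geometric triangulations\<close>

context
  fixes s :: "'g::euclidean_space set" and \<S> :: "'g set set" and T :: "'g set" and S :: "'g set set"
  assumes simplex: "3 simplex s" and geometric: "geometric_triangulation s \<S>"
    and T_def: "T = {v. v extreme_point_of s}"
    and S_def: "S = {A. \<not> affine_dependent A \<and> convex hull A \<in> \<S>}"
begin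

lemma simplex_vertices: "\<not> affine_dependent T" "card T = 4" "s = convex hull T"
proof -
  obtain C where C: "\<not> affine_dependent C" "card C = 4" "s = convex hull C"
    using simplex by (auto simp: simplex_def)
  then have "T = C" by (simp add: T_def extreme_point_of_convex_hull_affine_independent)
  then show "\<not> affine_dependent T" "card T = 4" "s = convex hull T" using C by auto
qed

lemma triangulation_cells: "simplicial_complex \<S>" "\<Union>\<S> = s"
  using geometric by (auto simp: geometric_triangulation_def)

lemma hull_image_cells: "(\<lambda>A. convex hull A) ` S = \<S>"
proof (intro equalityI subsetI)
  fix K assume K: "K \<in> \<S>"
  then obtain A where "\<not> affine_dependent A" "K = convex hull A"
    using triangulation_cells(1) unfolding simplicial_complex_def simplex_def by blast
  then show "K \<in> (\<lambda>A. convex hull A) ` S" using K by (auto simp: S_def)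
qed (auto simp: S_def)

text \<open>An affinely independent set is the set of extreme points of its hull, so
  \<open>S\<close> is as finite as \<open>\<S>\<close>; its subsets span faces of the hull, which
  gives closure under subsets.\<close>

lemma abstract_complex_cells: "abstract_complex S"
proof -
  have "A = {v. v extreme_point_of (convex hull A)}" if "A \<in> S" for A
    using that by (simp add: S_def extreme_point_of_convex_hull_affine_independent)
  then have "S \<subseteq> (\<lambda>K. {v. v extreme_point_of K}) ` \<S>"
    using hull_image_cells by blast
  moreover have "finite \<S>" using triangulation_cells(1) by (simp add: simplicial_complex_def)
  ultimately have "finite S" by (meson finite_surj)
  moreover have "S \<noteq> {}"
  proof -
    have "s \<noteq> {}" using simplex_vertices by auto
    then have "\<S> \<noteq> {}" using triangulation_cells(2) by auto
    then show ?thesis using hull_image_cells by blast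
  qed
  moreover have "finite F" if "F \<in> S" for F
    using that aff_independent_finite by (auto simp: S_def)
  moreover have "G \<in> S" if "F \<in> S" "G \<subseteq> F" for F G
  proof -
    have F: "\<not> affine_dependent F" "convex hull F \<in> \<S>" using that by (auto simp: S_def)
    then have "(convex hull G) face_of (convex hull F)"
      using that(2) by (auto simp: face_of_convex_hull_affine_independent)
    then have "convex hull G \<in> \<S>"
      using F(2) triangulation_cells(1) unfolding simplicial_complex_def by blast
    then show ?thesis using F(1) that(2) affine_dependent_subset by (auto simp: S_def)
  qed
  ultimately show ?thesis unfolding abstract_complex_def by blast
qed

lemma realization_cells: "geometric_realization id S"
  using triangulation_cells(1) hull_image_cells by (simp add: geometric_realization_def S_def)

lemma face_of_simplex_iff: "F face_of s \<longleftrightarrow> (\<exists>G\<subseteq>T. F = convex hull G)"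
  using face_of_convex_hull_affine_independent[OF simplex_vertices(1)] simplex_vertices(3) by auto

lemma realization_faces: "geometric_realization id (Pow T)"
proof -
  have ind: "\<not> affine_dependent G" if "G \<subseteq> T" for G
    using simplex_vertices(1) that affine_dependent_subset by blast
  have faces: "(\<lambda>G. convex hull G) ` Pow T = {F. F face_of s}"
    by (auto simp: face_of_simplex_iff)
  have "simplicial_complex {F. F face_of s}"
    unfolding simplicial_complex_def
  proof (intro conjI ballI allI impI)
    show "finite {F. F face_of s}"
      using simplex by (intro finite_polytope_faces simplex_imp_polytope)
    show "\<exists>n. n simplex F" if "F \<in> {F. F face_of s}" for F
    proof -
      have "\<exists>G\<subseteq>T. F = convex hull G" using that face_of_simplex_iff[of F] by simp
      then obtain G where "G \<subseteq> T" "F = convex hull G" by blast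
      then show ?thesis unfolding simplex_def using ind by (intro exI[of _ "int (card G) - 1"]) auto
    qed
    show "F \<in> {F. F face_of s}" if "K \<in> {F. F face_of s} \<and> F face_of K" for F K
      using that face_of_trans by blast
    show "(K \<inter> L) face_of K" if "K \<in> {F. F face_of s} \<and> L \<in> {F. F face_of s}" for K L
      using that face_of_Int[of K s L] face_of_subset[of "K \<inter> L" s K] face_of_imp_subset[of K s] by auto
  qed
  then show ?thesis using faces ind by (simp add: geometric_realization_def)
qed

text \<open>With points as their own vertices and the identity as homeomorphism, inducedness is
  automatic: the faces of \<open>s\<close> are convex, so a cell with all vertices in a face lies in
  it.\<close>

lemma induced_triangulation_cells: "induced_triangulation T id S id id"
  unfolding induced_triangulation_def
proof (intro conjI ballI)
  have "finite T" using simplex_vertices(1) aff_independent_finite by blast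
  then show "abstract_complex (Pow T)"
    by (auto simp: abstract_complex_def intro: finite_subset)
  show "abstract_complex S" "geometric_realization id S" "geometric_realization id (Pow T)"
    by (rule abstract_complex_cells realization_cells realization_faces)+
  have sup: "support id (Pow T) = s" "support id S = s"
    using support_Pow[of id T] simplex_vertices(3) triangulation_cells(2) hull_image_cells
    by (simp_all add: support_Union)
  have "\<forall>K\<in>\<S>. \<exists>h c. linear h \<and> (\<forall>x\<in>K. id x = h x + c)"
    by (rule ballI, rule exI[of _ id], rule exI[of _ 0]) (simp add: linear_id)
  then have "piecewise_linear_on s id"
    unfolding piecewise_linear_on_def using triangulation_cells by blast
  moreover have "homeomorphism s s id id" by (simp add: homeomorphism_def)
  ultimately show "pl_homeomorphism (support id (Pow T)) (support id S) id"
    unfolding sup pl_homeomorphism_def by blast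
  fix F assume "F \<in> Pow T"
  then have face: "(convex hull F) face_of s" using face_of_simplex_iff by blast
  define S' where "S' = {A \<in> S. A \<subseteq> convex hull F}"
  have cells: "finite S" "\<And>A B. \<lbrakk>A \<in> S; B \<subseteq> A\<rbrakk> \<Longrightarrow> B \<in> S" "\<And>A. A \<in> S \<Longrightarrow> finite A" "{} \<in> S"
    using abstract_complex_cells unfolding abstract_complex_def by auto
  have "abstract_complex S'"
    unfolding abstract_complex_def
  proof (intro conjI ballI allI impI)
    show "finite S'" using cells(1) by (simp add: S'_def)
    show "S' \<noteq> {}" using cells(4) by (auto simp: S'_def)
    show "finite A" if "A \<in> S'" for A using that cells(3) by (simp add: S'_def)
    show "B \<in> S'" if "A \<in> S'" "B \<subseteq> A" for A B using that cells(2) by (auto simp: S'_def)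
  qed
  moreover have "G \<in> S'" if "G \<in> S" "G \<subseteq> vert S'" for G
    using that by (auto simp: S'_def)
  ultimately have "induced_subcomplex S' S"
    unfolding induced_subcomplex_def by (simp add: S'_def)
  moreover have "support id S' = convex hull F"
  proof
    show "support id S' \<subseteq> convex hull F"
      unfolding support_def
    proof (rule UN_least)
      fix A assume "A \<in> S'"
      then show "convex hull (id ` A) \<subseteq> convex hull F"
        by (simp add: S'_def hull_minimal)
    qed
    show "convex hull F \<subseteq> support id S'"
    proof
      fix x assume x: "x \<in> convex hull F"
      then have "x \<in> \<Union>\<S>" using face face_of_imp_subset triangulation_cells(2) by blast
      then obtain K where K: "K \<in> \<S>" "x \<in> rel_interior K"
        using simplicial_complex_Union_rel_interiors[OF triangulation_cells(1)] by blast
      \<comment> \<open>A convex subset of \<open>s\<close> whose relative interior meets a face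
        lies in that face; hence the cells inside the face cover it.\<close>
      have "K \<subseteq> convex hull F"
        using subset_of_face_of[OF face, of K] K x triangulation_cells(2) by blast
      moreover obtain A where A: "A \<in> S" "K = convex hull A" using K(1) hull_image_cells by blast
      ultimately have "A \<in> S'" using hull_subset[of A convex] by (auto simp: S'_def)
      then show "x \<in> support id S'"
        using K(2) A(2) rel_interior_subset unfolding support_def by fastforce
    qed
  qed
  ultimately show "\<exists>S'. induced_subcomplex S' S \<and> id ` (convex hull (id ` F)) = support id S'"
    by auto
qed

lemma vert_cells: "vert S = geom_vert \<S>"
proof (intro equalityI subsetI)
  fix v assume "v \<in> vert S"
  then have "{v} \<in> S" using abstract_complex_cells unfolding abstract_complex_def by blast
  then show "v \<in> geom_vert \<S>" by (simp add: S_def geom_vert_def)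
next
  fix v assume "v \<in> geom_vert \<S>"
  then have "{v} \<in> S" by (simp add: S_def geom_vert_def)
  then show "v \<in> vert S" by blast
qed

lemma verts_in_rel_interiors_cells:
  "verts_in_rel_interiors k T id S id id = geom_verts_in_rel_interiors (int k) s \<S>"
proof -
  have "aff_dim (convex hull F) = int k \<longleftrightarrow> card F = k + 1" if "F \<subseteq> T" for F
    using aff_dim_face[OF _ realization_faces, of F] that simplex_vertices(2)
      induced_triangulation_cells by (auto simp: induced_triangulation_def)
  then show ?thesis
    by (auto simp: verts_in_rel_interiors_def geom_verts_in_rel_interiors_def vert_cells face_of_simplex_iff)
qed

lemma corners_cells:
  assumes "T \<subseteq> geom_vert \<S>"
  shows "verts_in_rel_interiors 0 T id S id id = T"
  using assms by (force simp: verts_in_rel_interiors_def vert_cells card_1_singleton_iff)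

lemma card_facets_cells: "card {F \<in> \<S>. 3 simplex F} = card (abstract_faces 3 S)"
proof -
  have "(\<lambda>A. convex hull A) ` abstract_faces 3 S = {F \<in> \<S>. 3 simplex F}"
  proof (intro equalityI subsetI)
    fix K assume K: "K \<in> {F \<in> \<S>. 3 simplex F}"
    then obtain A where "\<not> affine_dependent A" "card A = 4" "K = convex hull A"
      by (auto simp: simplex_def)
    then show "K \<in> (\<lambda>A. convex hull A) ` abstract_faces 3 S"
      using K by (auto simp: abstract_faces_def S_def)
  qed (auto simp: abstract_faces_def S_def simplex_def)
  moreover have "inj_on (\<lambda>A. convex hull A) S"
    using inj_on_hull[OF abstract_complex_cells realization_cells] by simp
  then have "inj_on (\<lambda>A. convex hull A) (abstract_faces 3 S)"
    by (rule inj_on_subset) (auto simp: abstract_faces_def)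
  ultimately show ?thesis using card_image by metis
qed

end

theorem theoremA22:
  fixes b2 b3 b4 b :: nat
  assumes "b = 4 + b2 + b3 + b4" and "b > 4"
  shows
    "(\<forall>(T :: 't set) (r :: 't \<Rightarrow> 'a::euclidean_space)
        (S :: 'v set set) (\<rho> :: 'v \<Rightarrow> 'e::euclidean_space) (\<phi> :: 'a \<Rightarrow> 'e).
        card T = 4 \<and> induced_triangulation T r S \<rho> \<phi> \<and>
        card (verts_in_rel_interiors 0 T r S \<rho> \<phi>) = 4 \<and>
        card (verts_in_rel_interiors 1 T r S \<rho> \<phi>) = b2 \<and>
        card (verts_in_rel_interiors 2 T r S \<rho> \<phi>) = b3 \<and>
        card (verts_in_rel_interiors 3 T r S \<rho> \<phi>) = b4
        \<longrightarrow> int (card (abstract_faces 3 S))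
              \<le> int (num_faces 3 (cyclic_polytope4 b)) - 2 * int b2 - int b3 - 1)
     \<and>
     (\<forall>(s :: 'g::euclidean_space set) (\<S> :: 'g set set).
        3 simplex s \<and> geometric_triangulation s \<S> \<and>
        {v. v extreme_point_of s} \<subseteq> geom_vert \<S> \<and>
        card (geom_verts_in_rel_interiors 1 s \<S>) = b2 \<and>
        card (geom_verts_in_rel_interiors 2 s \<S>) = b3 \<and>
        card (geom_verts_in_rel_interiors 3 s \<S>) = b4
        \<longrightarrow> int (card {F \<in> \<S>. 3 simplex F})
              \<le> int (num_faces 3 (cyclic_polytope4 b)) - 2 * int b2 - int b3 - 1)"
proof (intro conjI allI impI; elim conjE)
  have cyclic: "int b * (int b - 3) \<le> 2 * int (num_faces 3 (cyclic_polytope4 b))"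
    using assms(2) by (intro num_facets_cyclic_polytope4_ge) simp
  fix T :: "'t set" and r :: "'t \<Rightarrow> 'a" and S :: "'v set set" and \<rho> :: "'v \<Rightarrow> 'e" and \<phi> :: "'a \<Rightarrow> 'e"
  assume "card T = 4" "induced_triangulation T r S \<rho> \<phi>"
    "card (verts_in_rel_interiors 0 T r S \<rho> \<phi>) = 4" "card (verts_in_rel_interiors 1 T r S \<rho> \<phi>) = b2"
    "card (verts_in_rel_interiors 2 T r S \<rho> \<phi>) = b3" "card (verts_in_rel_interiors 3 T r S \<rho> \<phi>) = b4"
  then have "2 * int (card (abstract_faces 3 S)) \<le> int b * (int b - 3) - 4 * int b2 - 2 * int b3 - 2"
    using assms(1) by (intro card_facets_le)
  then show "int (card (abstract_faces 3 S))
      \<le> int (num_faces 3 (cyclic_polytope4 b)) - 2 * int b2 - int b3 - 1"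
    using cyclic by linarith
next
  have cyclic: "int b * (int b - 3) \<le> 2 * int (num_faces 3 (cyclic_polytope4 b))"
    using assms(2) by (intro num_facets_cyclic_polytope4_ge) simp
  fix s :: "'g set" and \<S> :: "'g set set"
  assume tri: "3 simplex s" "geometric_triangulation s \<S>"
    and vert: "{v. v extreme_point_of s} \<subseteq> geom_vert \<S>"
    and b: "card (geom_verts_in_rel_interiors 1 s \<S>) = b2" "card (geom_verts_in_rel_interiors 2 s \<S>) = b3"
      "card (geom_verts_in_rel_interiors 3 s \<S>) = b4"
  define T where "T = {v. v extreme_point_of s}"
  define S where "S = {A. \<not> affine_dependent A \<and> convex hull A \<in> \<S>}"
  note cells = tri T_def S_def
  have "card T = 4" by (rule simplex_vertices(2)[OF cells])
  moreover have "verts_in_rel_interiors 0 T id S id id = T"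
    using vert by (intro corners_cells[OF cells]) (simp add: T_def)
  ultimately have "2 * int (card (abstract_faces 3 S)) \<le> int b * (int b - 3) - 4 * int b2 - 2 * int b3 - 2"
    using b assms(1)
    by (intro card_facets_le[OF induced_triangulation_cells[OF cells]])
      (simp_all add: verts_in_rel_interiors_cells[OF cells])
  then show "int (card {F \<in> \<S>. 3 simplex F})
      \<le> int (num_faces 3 (cyclic_polytope4 b)) - 2 * int b2 - int b3 - 1"
    using cyclic card_facets_cells[OF cells] by linarith
qed

end
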